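(* There exists an absolute constant $c>0$ such that the following holds. Let $C$ be an isotropic convex body in $\mathbb{R}^n$ and let $K$ be an isotropic centrally symmetric convex body in $\mathbb{R}^n$ which is also $2$-convex with constant $\alpha>0$. Then for any $s\ge1$ and $\mathbf{t}=(t_1,\ldots,t_s)\in\mathbb{R}^s$, $$\|\mathbf{t}\|_{C^s,K}\ \le\ \frac{cL_C}{\sqrt{\alpha}}\,\|\mathbf{t}\|_2 .$$ In particular, for any centrally symmetric convex body $K$ in $\mathbb{R}^n$ which is $2$-convex with constant $\alpha>0$, and any $s\ge 1$, $\mathbf{t}\in\mathbb{R}^s$, $$\|\mathbf{t}\|_{K^s,K}\ \le\ \frac{c}{\alpha}\,\|\mathbf{t}\|_2 .$$
   Context: A convex body in $\mathbb{R}^n$ is a compact convex set with non-empty interior; it is centrally symmetric if $-K=K$. $\|x\|_K=\inf\{r>0:x\in rK\}$. A convex body $C$ is isotropic if it has volume $1$, its barycenter is at the origin, and there is $L_C>0$ with $\int_C\langle x,\xi\rangle^2dx=L_C^2$ for all $\xi\in S^{n-1}$. The modulus of convexity of a centrally symmetric convex body $K$ is $$\delta_K(\varepsilon)=\inf\Big\{1-\Big\|\frac{x+y}{2}\Big\|_K:\|x\|_K,\|y\|_K\le1,\ \|x-y\|_K\ge\varepsilon\Big\},\qquad \varepsilon\in(0,2],$$ and $K$ is $2$-convex with constant $\alpha$ if $\delta_K(\varepsilon)\ge\alpha\varepsilon^2$ for every $\varepsilon\in(0,2]$. Also $$\|\mathbf{t}\|_{C^s,K}=\frac{1}{\mathrm{vol}_n(C)^s}\int_C\cdots\int_C\Big\|\sum_{j=1}^st_jx_j\Big\|_K\,dx_1\cdots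 dx_s .$$ "Absolute constant" means independent of $n,s,C,K,\alpha,\mathbf{t}$. *)

theory Defs
  imports "HOL-Analysis.Analysis"
begin

text \<open>
  The constant of the theorem must not depend on the dimension, so the dimension has to be
  quantified inside the formula, which excludes index types such as \<open>real ^ 'n\<close>.  Instead
  \<open>\<real>\<^sup>n\<close> is the set of functions \<open>nat \<Rightarrow> real\<close> that are \<open>undefined\<close> outside \<open>{..<n}\<close>.  It is
  the underlying set both of the library's product topology and of its product measure, and
  the vector operations are restricted to \<open>{..<n}\<close> so that they stay in it.
\<close>

definition Rn :: "nat \<Rightarrow> (nat \<Rightarrow> real) set"
  where "Rn n = {..<n} \<rightarrow>\<^sub>E UNIV"

definition Rn_top :: "nat \<Rightarrow> (nat \<Rightarrow> real) topology"
  where "Rn_top n = product_topology (\<lambda>_. euclideanreal) {..<n}"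

definition Rn_lborel :: "nat \<Rightarrow> (nat \<Rightarrow> real) measure"
  where "Rn_lborel n = (\<Pi>\<^sub>M i\<in>{..<n}. lborel)"

lemma topspace_Rn_top [simp]: "topspace (Rn_top n) = Rn n"
  by (simp add: Rn_top_def Rn_def)

lemma space_Rn_lborel [simp]: "space (Rn_lborel n) = Rn n"
  by (simp add: Rn_lborel_def Rn_def space_PiM)

definition vol :: "nat \<Rightarrow> (nat \<Rightarrow> real) set \<Rightarrow> real"
  where "vol n C = measure (Rn_lborel n) C"

definition vadd :: "nat \<Rightarrow> (nat \<Rightarrow> real) \<Rightarrow> (nat \<Rightarrow> real) \<Rightarrow> nat \<Rightarrow> real"
  where "vadd n x y = (\<lambda>i\<in>{..<n}. x i + y i)"

definition vscale :: "nat \<Rightarrow> real \<Rightarrow> (nat \<Rightarrow> real) \<Rightarrow> nat \<Rightarrow> real"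
  where "vscale n r x = (\<lambda>i\<in>{..<n}. r * x i)"

definition vsub :: "nat \<Rightarrow> (nat \<Rightarrow> real) \<Rightarrow> (nat \<Rightarrow> real) \<Rightarrow> nat \<Rightarrow> real"
  where "vsub n x y = (\<lambda>i\<in>{..<n}. x i - y i)"

definition vlincomb :: "nat \<Rightarrow> nat \<Rightarrow> (nat \<Rightarrow> real) \<Rightarrow> (nat \<Rightarrow> nat \<Rightarrow> real) \<Rightarrow> nat \<Rightarrow> real"
  where "vlincomb n s t x = (\<lambda>i\<in>{..<n}. \<Sum>j<s. t j * x j i)"

definition vinner :: "nat \<Rightarrow> (nat \<Rightarrow> real) \<Rightarrow> (nat \<Rightarrow> real) \<Rightarrow> real"
  where "vinner n x y = (\<Sum>i<n. x i * y i)"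

definition vsphere :: "nat \<Rightarrow> (nat \<Rightarrow> real) set"
  where "vsphere n = {\<xi> \<in> Rn n. L2_set \<xi> {..<n} = 1}"

definition vconvex :: "nat \<Rightarrow> (nat \<Rightarrow> real) set \<Rightarrow> bool"
  where "vconvex n C \<longleftrightarrow>
    (\<forall>x\<in>C. \<forall>y\<in>C. \<forall>u\<ge>0. \<forall>v\<ge>0. u + v = 1 \<longrightarrow> vadd n (vscale n u x) (vscale n v y) \<in> C)"

definition convex_body :: "nat \<Rightarrow> (nat \<Rightarrow> real) set \<Rightarrow> bool"
  where "convex_body n C \<longleftrightarrow>
    compactin (Rn_top n) C \<and> vconvex n C \<and> Rn_top n interior_of C \<noteq> {}"

definition centrally_symmetric :: "nat \<Rightarrow> (nat \<Rightarrow> real) set \<Rightarrow> bool"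
  where "centrally_symmetric n K \<longleftrightarrow> vscale n (-1) ` K = K"

definition body_norm :: "nat \<Rightarrow> (nat \<Rightarrow> real) set \<Rightarrow> (nat \<Rightarrow> real) \<Rightarrow> real"
  where "body_norm n K x = Inf {r. r > 0 \<and> x \<in> vscale n r ` K}"

definition barycenter :: "nat \<Rightarrow> (nat \<Rightarrow> real) set \<Rightarrow> nat \<Rightarrow> real"
  where "barycenter n C = (\<lambda>i\<in>{..<n}. (LINT x:C|Rn_lborel n. x i) / vol n C)"

definition has_isotropic_constant :: "nat \<Rightarrow> (nat \<Rightarrow> real) set \<Rightarrow> real \<Rightarrow> bool"
  where "has_isotropic_constant n C L \<longleftrightarrow>
    L > 0 \<and> (\<forall>\<xi>\<in>vsphere n. (LINT x:C|Rn_lborel n. (vinner n x \<xi>)\<^sup>2) = L\<^sup>2)"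

definition isotropic :: "nat \<Rightarrow> (nat \<Rightarrow> real) set \<Rightarrow> bool"
  where "isotropic n C \<longleftrightarrow>
    vol n C = 1 \<and> barycenter n C = (\<lambda>i\<in>{..<n}. 0) \<and> (\<exists>L. has_isotropic_constant n C L)"

definition isotropic_constant :: "nat \<Rightarrow> (nat \<Rightarrow> real) set \<Rightarrow> real"
  where "isotropic_constant n C = (THE L. has_isotropic_constant n C L)"

lemma has_isotropic_constant_unique:
  assumes "n \<ge> 1" "has_isotropic_constant n C L" "has_isotropic_constant n C L'"
  shows "L = L'"
proof -
  define \<xi> :: "nat \<Rightarrow> real" where "\<xi> = (\<lambda>i\<in>{..<n}. if i = 0 then 1 else 0)"
  have "(\<Sum>i<n. (\<xi> i)\<^sup>2) = (\<Sum>i<n. if i = 0 then 1 else 0)"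
    by (rule sum.cong) (auto simp: \<xi>_def)
  also have "\<dots> = 1"
    using assms(1) by simp
  finally have "\<xi> \<in> vsphere n"
    by (auto simp: vsphere_def Rn_def L2_set_def \<xi>_def)
  then have "L\<^sup>2 = L'\<^sup>2" "L > 0" "L' > 0"
    using assms(2,3) by (auto simp: has_isotropic_constant_def)
  then show ?thesis
    by (simp add: power2_eq_iff_nonneg)
qed

lemma isotropic_constant_eqI:
  assumes "n \<ge> 1" "has_isotropic_constant n C L"
  shows "isotropic_constant n C = L"
  unfolding isotropic_constant_def
  using assms by (blast intro: has_isotropic_constant_unique)

definition modulus_of_convexity :: "nat \<Rightarrow> (nat \<Rightarrow> real) set \<Rightarrow> real \<Rightarrow> real"
  where "modulus_of_convexity n K \<epsilon> =
    Inf {1 - body_norm n K (vscale n (1/2) (vadd n x y)) | x y.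
          x \<in> Rn n \<and> y \<in> Rn n \<and> body_norm n K x \<le> 1 \<and> body_norm n K y \<le> 1 \<and>
          body_norm n K (vsub n x y) \<ge> \<epsilon>}"

definition two_convex :: "nat \<Rightarrow> (nat \<Rightarrow> real) set \<Rightarrow> real \<Rightarrow> bool"
  where "two_convex n K \<alpha> \<longleftrightarrow> (\<forall>\<epsilon>\<in>{0<..2}. modulus_of_convexity n K \<epsilon> \<ge> \<alpha> * \<epsilon>\<^sup>2)"

text \<open>
  The multiple integral is taken against the product measure on \<open>(\<real>\<^sup>n)\<^sup>s\<close>.  For convex bodies
  \<open>C\<close> and \<open>K\<close> with \<open>K\<close> centrally symmetric, the integrand is continuous and bounded on the
  compact set \<open>C\<^sup>s\<close>, so the default value \<open>0\<close> of a non-convergent integral does not arise.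
\<close>

definition multi_norm ::
    "nat \<Rightarrow> nat \<Rightarrow> (nat \<Rightarrow> real) set \<Rightarrow> (nat \<Rightarrow> real) set \<Rightarrow> (nat \<Rightarrow> real) \<Rightarrow> real"
  where "multi_norm n s C K t =
    1 / vol n C ^ s *
    (LINT x:({..<s} \<rightarrow>\<^sub>E C)|(\<Pi>\<^sub>M j\<in>{..<s}. Rn_lborel n). body_norm n K (vlincomb n s t x))"

end

theory Submission
  imports Defs "HOL-Probability.Distributions"
begin

text \<open>
  Let \<open>x\<^sub>1, \<dots>, x\<^sub>s\<close> be independent and uniform in \<open>C\<close>, so that the multi-integral norm is the mean of
  \<open>\<parallel>\<Sum> t\<^sub>j x\<^sub>j\<parallel>\<^sub>K\<close>.  The proof bounds \<open>\<parallel>\<cdot>\<parallel>\<^sub>K\<close> by a Euclidean norm, for which the mean is controlled by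
  the second moment: the mixed terms vanish because \<open>C\<close> is centred, and only \<open>\<Sum> t\<^sub>j\<^sup>2\<close> survives.
  
  The Euclidean comparison is where 2-convexity enters.  Let \<open>\<langle>\<cdot>,\<xi>\<rangle> \<le> h\<close> on \<open>K\<close>.  A point with
  \<open>\<langle>x,\<xi>\<rangle> > \<epsilon> h\<close> and one with \<open>\<langle>y,\<xi>\<rangle> \<le> 0\<close> are at \<open>K\<close>-distance at least \<open>\<epsilon>\<close>, so their midpoint lies in
  \<open>exp (-\<alpha> \<epsilon>\<^sup>2) K\<close>.  The second set fills at least half of \<open>K\<close>, and the Brunn-Minkowski inequality
  then bounds the share of \<open>K\<close> taken by the first one by \<open>2 exp (-2 \<alpha> n \<epsilon>\<^sup>2)\<close> (\<open>two_convex_tail\<close>).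
  Integrating the tail gives \<open>\<alpha> n \<integral>\<^sub>K \<langle>x,\<xi>\<rangle>\<^sup>2 dx \<le> 2 h\<^sup>2 |K|\<close> (\<open>two_convex_second_moment\<close>): the support
  function of \<open>K\<close> dominates the square root of \<open>\<alpha> n / 2\<close> times the \<open>L\<^sup>2\<close> norm of \<open>\<langle>\<cdot>,\<xi>\<rangle>\<close> for the
  uniform distribution on \<open>K\<close>.
  By duality, that is by separating a point from \<open>K\<close>, \<open>\<parallel>\<cdot>\<parallel>\<^sub>K\<close> is at most the dual Euclidean norm divided
  by the same factor (\<open>body_norm_le_functionals\<close>).
  
  If \<open>K\<close> is isotropic, the \<open>L\<^sup>2\<close> norm is \<open>L\<^sub>K |\<xi>|\<close>, and the bound obtained is a multiple of
  \<open>L\<^sub>C / (L\<^sub>K \<surd>\<alpha>)\<close>; the constant \<open>L\<^sub>K\<close> is bounded below by an absolute constant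
  (\<open>isotropic_constant_lower_bound\<close>).  For \<open>C = K\<close> an isotropic position can be avoided by
  taking the Euclidean norm to be the one given by the covariance of \<open>K\<close> itself: \<open>n\<close> functionals that
  are orthonormal for it have total second moment \<open>n\<close>, which cancels the \<open>n\<close> in the comparison and
  leaves \<open>2 / \<surd>\<alpha>\<close> (\<open>multi_norm_self_le\<close>).  This is at most a multiple of \<open>1 / \<alpha>\<close> since
  \<open>\<alpha> \<le> 1\<close> (\<open>two_convex_constant_le_1\<close>).
  
  The Brunn-Minkowski inequality is used in its multiplicative form, which follows from the
  Prekopa-Leindler inequality; the latter passes from dimension \<open>n\<close> to \<open>n + 1\<close> by Fubini.
\<close>

section \<open>The Prekopa-Leindler inequality\<close>

text \<open>
  Write \<open>f x\<close> as the length of \<open>{0..<f x}\<close> and exchange the two integrals.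
\<close>

lemma nn_integral_layer_cake:
  fixes f :: "'a \<Rightarrow> real"
  assumes "sigma_finite_measure M" and f[measurable]: "f \<in> borel_measurable M"
    and nonneg: "\<And>x. x \<in> space M \<Longrightarrow> 0 \<le> f x"
  shows "(\<integral>\<^sup>+x. ennreal (f x) \<partial>M)
    = (\<integral>\<^sup>+t. emeasure M {x \<in> space M. t < f x} * indicator {0..} t \<partial>lborel)"
proof -
  interpret sigma_finite_measure M by fact
  interpret pair_sigma_finite M lborel ..
  have "(\<integral>\<^sup>+x. ennreal (f x) \<partial>M) = (\<integral>\<^sup>+x. (\<integral>\<^sup>+t. indicator {0..} t * indicator {t. t < f x} t \<partial>lborel) \<partial>M)"
  proof (rule nn_integral_cong)
    fix x assume x: "x \<in> space M"
    have "(\<integral>\<^sup>+t. indicator {0..} t * indicator {t. t < f x} t \<partial>lborel) = (\<integral>\<^sup>+t. indicator {0..<f x} t \<partial>lborel)"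
      by (rule nn_integral_cong) (auto simp: indicator_def)
    also have "\<dots> = ennreal (f x)"
      using nonneg[OF x] by simp
    finally show "ennreal (f x) = (\<integral>\<^sup>+t. indicator {0..} t * indicator {t. t < f x} t \<partial>lborel)" by simp
  qed
  also have "\<dots> = (\<integral>\<^sup>+t. (\<integral>\<^sup>+x. indicator {0..} t * indicator {t. t < f x} t \<partial>M) \<partial>lborel)"
    by (rule Fubini'[symmetric]) measurable
  also have "\<dots> = (\<integral>\<^sup>+t. emeasure M {x \<in> space M. t < f x} * indicator {0..} t \<partial>lborel)"
  proof (rule nn_integral_cong)
    fix t :: real
    have "(\<integral>\<^sup>+x. indicator {0..} t * indicator {t. t < f x} t \<partial>M)
       = (\<integral>\<^sup>+x. indicator {0..} t * indicator {x \<in> space M. t < f x} x \<partial>M)"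
      by (rule nn_integral_cong) (auto simp: indicator_def)
    also have "\<dots> = indicator {0..} t * emeasure M {x \<in> space M. t < f x}"
      by (subst nn_integral_cmult_indicator) auto
    finally show "(\<integral>\<^sup>+x. indicator {0..} t * indicator {t. t < f x} t \<partial>M)
       = emeasure M {x \<in> space M. t < f x} * indicator {0..} t" by (simp add: mult.commute)
  qed
  finally show ?thesis .
qed

lemma emeasure_lborel_vimage_midpoint:
  fixes H :: "real set"
  assumes [measurable]: "H \<in> sets borel"
  shows "emeasure lborel ((\<lambda>x. (x + b) / 2) -` H) = 2 * emeasure lborel H"
proof -
  let ?T = "\<lambda>x::real. b / 2 + (1/2) * x"
  have "emeasure lborel H = emeasure (density (distr lborel borel ?T) (\<lambda>_. ennreal \<bar>1/2\<bar>)) H"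
    using lborel_real_affine[of "1/2" "b/2"] by simp
  also have "\<dots> = ennreal (1/2) * emeasure (distr lborel borel ?T) H"
    by (subst emeasure_density) (auto simp: nn_integral_cmult_indicator)
  also have "emeasure (distr lborel borel ?T) H = emeasure lborel (?T -` H)"
    by (subst emeasure_distr) auto
  finally have "2 * emeasure lborel H = (2 * ennreal (1/2)) * emeasure lborel (?T -` H)"
    by (simp add: mult.assoc)
  also have "2 * ennreal (1/2) = 1"
    by (metis ennreal_1 ennreal_mult' ennreal_numeral mult.commute nonzero_eq_divide_eq zero_le_numeral zero_neq_numeral)
  finally show ?thesis by (simp add: add_divide_distrib add.commute)
qed

text \<open>
  With \<open>a\<close> close to the supremum of \<open>A\<close> and \<open>b\<close> close to the infimum of \<open>B\<close>, the sets \<open>(A + b) / 2\<close> and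
  \<open>(a + B) / 2\<close> both lie in \<open>H\<close> and overlap only near \<open>(a + b) / 2\<close>.  Since \<open>a\<close> and \<open>b\<close> are elements of the two sets, approximating
  the supremum and the infimum costs only an arbitrarily small error \<open>e\<close>.
\<close>

lemma brunn_minkowski_real:
  fixes A B H :: "real set"
  assumes [measurable]: "A \<in> sets borel" "B \<in> sets borel" "H \<in> sets borel"
    and ne: "A \<noteq> {}" "B \<noteq> {}" and bd: "bdd_above A" "bdd_below B"
    and mid: "\<And>a b. a \<in> A \<Longrightarrow> b \<in> B \<Longrightarrow> (a + b) / 2 \<in> H"
  shows "emeasure lborel A + emeasure lborel B \<le> 2 * emeasure lborel H"
proof (rule ennreal_le_epsilon)
  fix e :: real assume e: "0 < e" 
  obtain a where a: "a \<in> A" "Sup A - e / 2 < a"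
    using less_cSup_iff[of A "Sup A - e/2"] ne bd e by auto
  obtain b where b: "b \<in> B" "b < Inf B + e / 2"
    using cInf_less_iff[of B "Inf B + e/2"] ne bd e by auto
  let ?c = "(a + b) / 2"
  have "emeasure lborel A \<le> emeasure lborel ((A \<inter> {..<a}) \<union> {a..Sup A})"
    by (rule emeasure_mono) (use cSup_upper[OF _ bd(1)] in \<open>force+\<close>)
  also have "\<dots> \<le> emeasure lborel (A \<inter> {..<a}) + emeasure lborel {a..Sup A}"
    by (rule emeasure_subadditive) auto
  also have "emeasure lborel (A \<inter> {..<a}) \<le> emeasure lborel ((\<lambda>x. (x + b) / 2) -` (H \<inter> {..<?c}))"
    by (rule emeasure_mono) (use mid b in \<open>auto intro!: measurable_sets_borel[OF _, of _ borel] \<close>)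
  also have "\<dots> = 2 * emeasure lborel (H \<inter> {..<?c})"
    by (rule emeasure_lborel_vimage_midpoint) auto
  also have "emeasure lborel {a..Sup A} \<le> ennreal (e/2)"
    using a e cSup_upper[OF a(1) bd(1)] by (simp add: ennreal_leI)
  finally have 1: "emeasure lborel A \<le> 2 * emeasure lborel (H \<inter> {..<?c}) + ennreal (e/2)"
    by (auto intro: add_mono)
  have "emeasure lborel B \<le> emeasure lborel ((B \<inter> {b<..}) \<union> {Inf B..b})"
    by (rule emeasure_mono) (use cInf_lower[OF _ bd(2)] in \<open>force+\<close>)
  also have "\<dots> \<le> emeasure lborel (B \<inter> {b<..}) + emeasure lborel {Inf B..b}"
    by (rule emeasure_subadditive) auto
  also have "emeasure lborel (B \<inter> {b<..}) \<le> emeasure lborel ((\<lambda>x. (x + a) / 2) -` (H \<inter> {?c<..}))"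
    by (rule emeasure_mono)
      (use mid[OF a(1)] in \<open>auto intro!: measurable_sets_borel[OF _, of _ borel] simp: add.commute[of _ a]\<close>)
  also have "\<dots> = 2 * emeasure lborel (H \<inter> {?c<..})"
    by (rule emeasure_lborel_vimage_midpoint) auto
  also have "emeasure lborel {Inf B..b} \<le> ennreal (e/2)"
    using b e cInf_lower[OF b(1) bd(2)] by (simp add: ennreal_leI)
  finally have 2: "emeasure lborel B \<le> 2 * emeasure lborel (H \<inter> {?c<..}) + ennreal (e/2)"
    by (auto intro: add_mono)
  have "emeasure lborel (H \<inter> {..<?c}) + emeasure lborel (H \<inter> {?c<..})
      = emeasure lborel (H \<inter> {..<?c} \<union> H \<inter> {?c<..})"
    by (rule plus_emeasure) auto
  also have "\<dots> \<le> emeasure lborel H"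
    by (rule emeasure_mono) auto
  finally have 3: "emeasure lborel (H \<inter> {..<?c}) + emeasure lborel (H \<inter> {?c<..}) \<le> emeasure lborel H" .
  have "emeasure lborel A + emeasure lborel B
      \<le> (2 * emeasure lborel (H \<inter> {..<?c}) + ennreal (e/2)) + (2 * emeasure lborel (H \<inter> {?c<..}) + ennreal (e/2))"
    using 1 2 by (rule add_mono)
  also have "\<dots> = 2 * (emeasure lborel (H \<inter> {..<?c}) + emeasure lborel (H \<inter> {?c<..})) + (ennreal (e/2) + ennreal (e/2))"
    by (simp add: algebra_simps)
  also have "ennreal (e/2) + ennreal (e/2) = ennreal e"
    using e by (subst ennreal_plus[symmetric]) auto
  also have "2 * (emeasure lborel (H \<inter> {..<?c}) + emeasure lborel (H \<inter> {?c<..})) \<le> 2 * emeasure lborel H"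
    using 3 by (rule mult_left_mono) simp
  finally show "emeasure lborel A + emeasure lborel B \<le> 2 * emeasure lborel H + ennreal e"
    by (auto intro: add_mono)
qed


lemma ennreal_mult_le_power2_of_add_le:
  fixes a b c :: ennreal
  assumes "a + b \<le> 2 * c"
  shows "a * b \<le> c\<^sup>2"
proof (cases "c = top")
  case False
  then have "2 * c \<noteq> top" by (simp add: ennreal_mult_eq_top_iff)
  then have "a \<noteq> top" "b \<noteq> top" using assms by (auto simp: top_unique)
  then obtain x y z where r: "a = ennreal x" "b = ennreal y" "c = ennreal z" "x \<ge> 0" "y \<ge> 0" "z \<ge> 0"
    using False by (metis ennreal_cases)
  have "ennreal (x + y) \<le> ennreal (2 * z)"
    using assms r by (simp add: ennreal_plus ennreal_mult')
  then have "x + y \<le> 2 * z" using r by (subst (asm) ennreal_le_iff) auto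
  then have "(x + y)\<^sup>2 \<le> (2 * z)\<^sup>2" using r by (intro power_mono) auto
  moreover have "4 * (x * y) \<le> (x + y)\<^sup>2"
    using zero_le_power2[of "x - y"] by (simp add: power2_eq_square algebra_simps)
  ultimately have "x * y \<le> z\<^sup>2" by (simp add: power2_eq_square)
  then have "ennreal (x * y) \<le> ennreal (z\<^sup>2)" by (rule ennreal_leI)
  then show ?thesis using r by (simp add: ennreal_mult ennreal_power)
qed simp

text \<open>
  Divide \<open>f\<close> and \<open>g\<close> by their suprema \<open>F\<close> and \<open>G\<close>, and \<open>h\<close> by \<open>m = \<surd>(F G)\<close>.  Then for every \<open>t < 1\<close> the
  superlevel sets of \<open>f / F\<close> and \<open>g / G\<close> at height \<open>t\<close> are non-empty, and their midpoints lie in that of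
  \<open>h / m\<close>.  The one-dimensional Brunn-Minkowski inequality and the layer-cake formula give an additive
  inequality between the integrals, and the inequality of arithmetic and geometric means turns it into
  the multiplicative one.
\<close>

lemma prekopa_leindler_real_bounded:
  fixes f g :: "real \<Rightarrow> real" and h :: "real \<Rightarrow> ennreal"
  assumes [measurable]: "f \<in> borel_measurable borel" "g \<in> borel_measurable borel" "h \<in> borel_measurable borel"
    and nonneg: "\<And>x. 0 \<le> f x" "\<And>x. 0 \<le> g x"
    and bd: "bdd_above (range f)" "bdd_above (range g)"
    and supp: "bdd_above {x. f x \<noteq> 0}" "bdd_below {x. g x \<noteq> 0}"
    and le: "\<And>a b. ennreal (f a * g b) \<le> (h ((a + b) / 2))\<^sup>2"
  shows "(\<integral>\<^sup>+x. f x \<partial>lborel) * (\<integral>\<^sup>+x. g x \<partial>lborel) \<le> (\<integral>\<^sup>+x. h x \<partial>lborel)\<^sup>2"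
proof (cases "(\<forall>x. f x = 0) \<or> (\<forall>x. g x = 0)")
  case True
  then show ?thesis by auto
next
  case False
  define F where "F = Sup (range f)"
  define G where "G = Sup (range g)"
  have fF: "f x \<le> F" for x unfolding F_def by (rule cSup_upper) (use bd in auto)
  have gG: "g x \<le> G" for x unfolding G_def by (rule cSup_upper) (use bd in auto)
  have pos: "F > 0" "G > 0"
    using False fF gG nonneg by (metis order.not_eq_order_implies_strict order_le_less_trans)+
  define m where "m = sqrt (F * G)"
  have m: "m > 0" "m\<^sup>2 = F * G" using pos by (auto simp: m_def)
  \<comment> \<open>Only heights below \<open>m\<close> matter, so \<open>h\<close> is cut off there and becomes real-valued.\<close>
  define k where "k x = enn2real (min (h x) (ennreal m)) / m" for x
  have [measurable]: "k \<in> borel_measurable borel" unfolding k_def by measurable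
  have k0: "0 \<le> k x" for x using m by (simp add: k_def)
  have mk: "ennreal (m * k x) \<le> h x" for x
  proof -
    have "min (h x) (ennreal m) < top" by (simp add: min_less_iff_disj)
    then show ?thesis using m by (simp add: k_def)
  qed
  have key: "emeasure lborel {x. t < f x / F} + emeasure lborel {x. t < g x / G}
      \<le> 2 * emeasure lborel {x. t < k x}" if t: "0 \<le> t" for t
  proof (cases "t < 1")
    case t1: True
    show ?thesis
    proof (rule brunn_minkowski_real)
      have "\<exists>x\<in>range f. t * F < x"
        using less_cSup_iff[of "range f" "t * F"] bd pos t1 by (auto simp: F_def)
      then show "{x. t < f x / F} \<noteq> {}" using pos by (auto simp: field_simps)
      have "\<exists>x\<in>range g. t * G < x"
        using less_cSup_iff[of "range g" "t * G"] bd pos t1 by (auto simp: G_def)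
      then show "{x. t < g x / G} \<noteq> {}" using pos by (auto simp: field_simps)
      show "bdd_above {x. t < f x / F}" by (rule bdd_above_mono[OF supp(1)]) (use t in auto)
      show "bdd_below {x. t < g x / G}" by (rule bdd_below_mono[OF supp(2)]) (use t in auto)
      fix a b assume "a \<in> {x. t < f x / F}" "b \<in> {x. t < g x / G}"
      then have ab: "t * F < f a" "t * G < g b" using pos by (auto simp: field_simps)
      have "(t * m)\<^sup>2 = (t * F) * (t * G)" by (simp add: power_mult_distrib m(2) power2_eq_square[of t])
      also have "\<dots> < f a * g b"
        using ab t pos by (intro mult_strict_mono') auto
      finally have lt: "(t * m)\<^sup>2 < f a * g b" .
      show "(a + b) / 2 \<in> {x. t < k x}"
      proof (cases "h ((a + b) / 2) \<ge> ennreal m")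
        case True
        then show ?thesis using m t1 by (simp add: k_def min_absorb2)
      next
        case False
        then have "h ((a + b) / 2) < ennreal m" by simp
        then obtain r where r: "h ((a + b) / 2) = ennreal r" "0 \<le> r" "r < m"
          by (metis ennreal_cases ennreal_less_iff less_top not_less_iff_gr_or_eq order_less_trans)
        have "ennreal (f a * g b) \<le> ennreal (r\<^sup>2)" using le[of a b] r by (simp add: ennreal_power)
        then have "f a * g b \<le> r\<^sup>2" by (subst (asm) ennreal_le_iff) auto
        then have "t * m < r" using lt r by (meson order_less_le_trans power_less_imp_less_base)
        then show ?thesis using r m False by (simp add: k_def min_absorb1 field_simps)
      qed
    qed measurable
  next
    case False
    have "f x / F \<le> 1" "g x / G \<le> 1" for x using fF[of x] gG[of x] pos by simp_all
    then have "{x. t < f x / F} = {}" "{x. t < g x / G} = {}" using False by (auto simp: not_less intro: order.trans)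
    then show ?thesis by simp
  qed
  have lc: "(\<integral>\<^sup>+x. ennreal (u x) \<partial>lborel) = (\<integral>\<^sup>+t. emeasure lborel {x. t < u x} * indicator {0..} t \<partial>lborel)"
    if [measurable]: "u \<in> borel_measurable borel" and "\<And>x. 0 \<le> u x" for u :: "real \<Rightarrow> real"
    using nn_integral_layer_cake[of lborel u] that sigma_finite_lborel by simp
  have "(\<integral>\<^sup>+x. ennreal (f x / F) \<partial>lborel) + (\<integral>\<^sup>+x. ennreal (g x / G) \<partial>lborel)
    = (\<integral>\<^sup>+t. emeasure lborel {x. t < f x / F} * indicator {0..} t
        + emeasure lborel {x. t < g x / G} * indicator {0..} t \<partial>lborel)"
    using nonneg pos by (simp add: lc nn_integral_add)
  also have "\<dots> \<le> (\<integral>\<^sup>+t. 2 * (emeasure lborel {x. t < k x} * indicator {0..} t) \<partial>lborel)"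
    by (rule nn_integral_mono) (use key in \<open>auto simp: indicator_def\<close>)
  also have "\<dots> = 2 * (\<integral>\<^sup>+x. ennreal (k x) \<partial>lborel)"
    by (simp add: nn_integral_cmult lc k0)
  finally have "(\<integral>\<^sup>+x. ennreal (f x / F) \<partial>lborel) * (\<integral>\<^sup>+x. ennreal (g x / G) \<partial>lborel)
      \<le> (\<integral>\<^sup>+x. ennreal (k x) \<partial>lborel)\<^sup>2"
    by (rule ennreal_mult_le_power2_of_add_le)
  then have "ennreal (m\<^sup>2) * ((\<integral>\<^sup>+x. ennreal (f x / F) \<partial>lborel) * (\<integral>\<^sup>+x. ennreal (g x / G) \<partial>lborel))
      \<le> ennreal (m\<^sup>2) * (\<integral>\<^sup>+x. ennreal (k x) \<partial>lborel)\<^sup>2"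
    by (rule mult_left_mono) simp
  also have "\<dots> = (\<integral>\<^sup>+x. ennreal (m * k x) \<partial>lborel)\<^sup>2"
    using m k0 by (simp add: ennreal_mult nn_integral_cmult power_mult_distrib ennreal_power)
  also have "\<dots> \<le> (\<integral>\<^sup>+x. h x \<partial>lborel)\<^sup>2"
    by (intro power_mono nn_integral_mono mk) simp
  also have "ennreal (m\<^sup>2) * ((\<integral>\<^sup>+x. ennreal (f x / F) \<partial>lborel) * (\<integral>\<^sup>+x. ennreal (g x / G) \<partial>lborel))
    = (ennreal F * (\<integral>\<^sup>+x. ennreal (f x / F) \<partial>lborel)) * (ennreal G * (\<integral>\<^sup>+x. ennreal (g x / G) \<partial>lborel))"
    using pos by (simp add: m ennreal_mult mult_ac)
  also have "ennreal F * (\<integral>\<^sup>+x. ennreal (f x / F) \<partial>lborel) = (\<integral>\<^sup>+x. f x \<partial>lborel)"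
    using pos nonneg by (subst nn_integral_cmult[symmetric]) (auto simp: ennreal_mult[symmetric])
  also have "ennreal G * (\<integral>\<^sup>+x. ennreal (g x / G) \<partial>lborel) = (\<integral>\<^sup>+x. g x \<partial>lborel)"
    using pos nonneg by (subst nn_integral_cmult[symmetric]) (auto simp: ennreal_mult[symmetric])
  finally show ?thesis .
qed

lemma nn_integral_SUP_truncation:
  fixes f :: "real \<Rightarrow> ennreal"
  assumes [measurable]: "f \<in> borel_measurable borel"
  shows "(\<integral>\<^sup>+x. f x \<partial>lborel)
    = (SUP k::nat. \<integral>\<^sup>+x. ennreal (enn2real (min (f x) (of_nat k)) * indicator {- real k..real k} x) \<partial>lborel)"
proof -
  let ?u = "\<lambda>k x. ennreal (enn2real (min (f x) (of_nat k)) * indicator {- real k..real k} x)"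
  have u: "?u k x = (if \<bar>x\<bar> \<le> real k then min (f x) (of_nat k) else 0)" for k x
  proof -
    have "min (f x) (of_nat k) < top" by (simp add: min_less_iff_disj ennreal_of_nat_eq_real_of_nat)
    then show ?thesis by (auto simp: indicator_def abs_le_iff)
  qed
  have "(SUP k. ?u k x) = f x" for x
  proof (rule antisym)
    show "(SUP k. ?u k x) \<le> f x" unfolding u by (intro SUP_least) auto
    have *: "min (f x) (of_nat k) \<le> (SUP k. ?u k x)" for k
    proof -
      obtain l where "\<bar>x\<bar> \<le> real l" using real_arch_simple by blast
      then have "min (f x) (of_nat k) \<le> ?u (max k l) x"
        unfolding u by (auto simp: min_def max_def intro: order.trans)
      also have "\<dots> \<le> (SUP k. ?u k x)" by (rule SUP_upper) simp
      finally show ?thesis .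
    qed
    have "f x = (SUP k::nat. min (f x) (of_nat k))"
      using inf_SUP[of "f x" "\<lambda>k::nat. of_nat k" UNIV] by (simp only: ennreal_SUP_of_nat_eq_top inf_min) simp
    also have "\<dots> \<le> (SUP k. ?u k x)" using * by (rule SUP_least)
    finally show "f x \<le> (SUP k. ?u k x)" .
  qed
  then have "(\<integral>\<^sup>+x. f x \<partial>lborel) = (\<integral>\<^sup>+x. (SUP k. ?u k x) \<partial>lborel)" by simp
  also have "\<dots> = (SUP k. \<integral>\<^sup>+x. ?u k x \<partial>lborel)"
  proof (rule nn_integral_monotone_convergence_SUP)
    show "incseq ?u" 
      unfolding incseq_def le_fun_def u by (auto simp: min_def intro: order.trans)
  qed measurable
  finally show ?thesis .
qed

text \<open>
  Both factors are truncated, in value and in support, by independent indices, so that the two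
  suprema can be pulled out of the product one after the other.
\<close>

lemma prekopa_leindler_real:
  fixes f g h :: "real \<Rightarrow> ennreal"
  assumes [measurable]: "f \<in> borel_measurable borel" "g \<in> borel_measurable borel" "h \<in> borel_measurable borel"
    and le: "\<And>a b. f a * g b \<le> (h ((a + b) / 2))\<^sup>2"
  shows "(\<integral>\<^sup>+x. f x \<partial>lborel) * (\<integral>\<^sup>+x. g x \<partial>lborel) \<le> (\<integral>\<^sup>+x. h x \<partial>lborel)\<^sup>2"
proof -
  define u :: "(real \<Rightarrow> ennreal) \<Rightarrow> nat \<Rightarrow> real \<Rightarrow> real"
    where "u f k x = enn2real (min (f x) (of_nat k)) * indicator {- real k..real k} x" for f k x
  have u_le: "ennreal (u f k x) \<le> f x" for f k x
  proof -
    have "min (f x) (of_nat k) < top" by (simp add: min_less_iff_disj ennreal_of_nat_eq_real_of_nat)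
    then show ?thesis by (auto simp: u_def indicator_def)
  qed
  have u_nonneg: "0 \<le> u f k x" for f k x by (simp add: u_def)
  have u_bd: "u f k x \<le> real k" for f k x
  proof -
    have "enn2real (min (f x) (of_nat k)) \<le> enn2real (of_nat k)"
      by (intro enn2real_mono) (auto simp: less_top[symmetric])
    then show ?thesis by (auto simp: u_def indicator_def)
  qed
  have "(\<integral>\<^sup>+x. u f k x \<partial>lborel) * (\<integral>\<^sup>+x. u g l x \<partial>lborel) \<le> (\<integral>\<^sup>+x. h x \<partial>lborel)\<^sup>2" for k l
  proof (rule prekopa_leindler_real_bounded)
    show "u f k \<in> borel_measurable borel" "u g l \<in> borel_measurable borel"
      unfolding u_def by measurable
    show "bdd_above (range (u f k))" "bdd_above (range (u g l))"
      using u_bd by (auto intro!: bdd_aboveI2)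
    show "bdd_above {x. u f k x \<noteq> 0}" 
      by (rule bdd_aboveI[of _ "real k"]) (auto simp: u_def indicator_def split: if_splits)
    show "bdd_below {x. u g l x \<noteq> 0}" 
      by (rule bdd_belowI[of _ "- real l"]) (auto simp: u_def indicator_def split: if_splits)
    fix a b
    have "ennreal (u f k a * u g l b) \<le> f a * g b"
      using u_nonneg by (simp add: ennreal_mult mult_mono u_le)
    then show "ennreal (u f k a * u g l b) \<le> (h ((a + b) / 2))\<^sup>2" using le order.trans by blast
  qed (use u_nonneg in auto)
  then have "(SUP k. \<integral>\<^sup>+x. u f k x \<partial>lborel) * (SUP l. \<integral>\<^sup>+x. u g l x \<partial>lborel) \<le> (\<integral>\<^sup>+x. h x \<partial>lborel)\<^sup>2"
    by (simp add: SUP_mult_left_ennreal SUP_mult_right_ennreal SUP_le_iff)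
  then show ?thesis unfolding u_def by (simp add: nn_integral_SUP_truncation[symmetric])
qed

text \<open>
  Fixing the last coordinates \<open>a\<close>, \<open>b\<close> and \<open>(a + b) / 2\<close>, the induction hypothesis gives the hypothesis
  of the one-dimensional inequality for the integrals over the first \<open>n\<close> coordinates.
\<close>

theorem prekopa_leindler:
  assumes "f \<in> borel_measurable (Rn_lborel n)" "g \<in> borel_measurable (Rn_lborel n)"
    "h \<in> borel_measurable (Rn_lborel n)"
    and "\<And>x y. x \<in> Rn n \<Longrightarrow> y \<in> Rn n \<Longrightarrow> f x * g y \<le> (h (vscale n (1/2) (vadd n x y)) :: ennreal)\<^sup>2"
  shows "(\<integral>\<^sup>+x. f x \<partial>Rn_lborel n) * (\<integral>\<^sup>+x. g x \<partial>Rn_lborel n) \<le> (\<integral>\<^sup>+x. h x \<partial>Rn_lborel n)\<^sup>2"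
  using assms
proof (induction n arbitrary: f g h)
  case 0
  have "vscale 0 (1/2) (vadd 0 (\<lambda>_. undefined) (\<lambda>_. undefined)) = (\<lambda>_. undefined)"
    by (auto simp: vscale_def)
  then show ?case using 0(4)[of "\<lambda>_. undefined" "\<lambda>_. undefined"]
    by (simp add: Rn_lborel_def Rn_def PiM_empty nn_integral_count_space_finite)
next
  case (Suc n)
  interpret product_sigma_finite "\<lambda>_::nat. lborel :: real measure" ..
  have eq: "Rn_lborel (Suc n) = Pi\<^sub>M (insert n {..<n}) (\<lambda>_. lborel)"
    by (simp add: Rn_lborel_def lessThan_Suc)
  note prems[measurable] = Suc.prems(1-3)[unfolded eq]
  have sf: "sigma_finite_measure (Pi\<^sub>M {..<n} (\<lambda>_. lborel :: real measure))"
    by (rule sigma_finite) simp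
  have split: "(\<integral>\<^sup>+x. u x \<partial>Rn_lborel (Suc n)) = (\<integral>\<^sup>+a. \<integral>\<^sup>+x. u (x(n := a)) \<partial>Rn_lborel n \<partial>lborel)"
    if "u \<in> borel_measurable (Pi\<^sub>M (insert n {..<n}) (\<lambda>_. lborel))" for u :: "_ \<Rightarrow> ennreal"
    unfolding eq by (subst product_nn_integral_insert_rev[OF _ _ that]) (auto simp: Rn_lborel_def)
  have meas: "(\<lambda>a. \<integral>\<^sup>+x. u (x(n := a)) \<partial>Rn_lborel n) \<in> borel_measurable borel"
    if [measurable]: "u \<in> borel_measurable (Pi\<^sub>M (insert n {..<n}) (\<lambda>_. lborel))" for u :: "_ \<Rightarrow> ennreal"
    unfolding Rn_lborel_def
    by (rule sigma_finite_measure.borel_measurable_nn_integral[OF sf]) measurable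
  have meas': "(\<lambda>x. u (x(n := a))) \<in> borel_measurable (Rn_lborel n)"
    if [measurable]: "u \<in> borel_measurable (Pi\<^sub>M (insert n {..<n}) (\<lambda>_. lborel))" for u :: "_ \<Rightarrow> ennreal" and a
    unfolding Rn_lborel_def by measurable
  have "(\<integral>\<^sup>+a. \<integral>\<^sup>+x. f (x(n := a)) \<partial>Rn_lborel n \<partial>lborel) * (\<integral>\<^sup>+a. \<integral>\<^sup>+x. g (x(n := a)) \<partial>Rn_lborel n \<partial>lborel)
      \<le> (\<integral>\<^sup>+a. \<integral>\<^sup>+x. h (x(n := a)) \<partial>Rn_lborel n \<partial>lborel)\<^sup>2"
  proof (rule prekopa_leindler_real)
    fix a b :: real
    show "(\<integral>\<^sup>+x. f (x(n := a)) \<partial>Rn_lborel n) * (\<integral>\<^sup>+x. g (x(n := b)) \<partial>Rn_lborel n)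
        \<le> (\<integral>\<^sup>+x. h (x(n := (a + b) / 2)) \<partial>Rn_lborel n)\<^sup>2"
    proof (rule Suc.IH)
      fix x y assume xy: "x \<in> Rn n" "y \<in> Rn n"
      then have in_Rn: "x(n := a) \<in> Rn (Suc n)" "y(n := b) \<in> Rn (Suc n)"
        by (auto simp: Rn_def PiE_iff extensional_def less_Suc_eq)
      have [simp]: "vscale (Suc n) (1/2) (vadd (Suc n) (x(n := a)) (y(n := b)))
         = (vscale n (1/2) (vadd n x y))(n := (a + b) / 2)"
        by (auto simp: vscale_def vadd_def fun_eq_iff less_Suc_eq)
      then show "f (x(n := a)) * g (y(n := b)) \<le> (h ((vscale n (1/2) (vadd n x y))(n := (a + b) / 2)))\<^sup>2"
        using Suc.prems(4)[OF in_Rn] by (simp only:)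
    qed (rule meas', rule prems)+
  qed (rule meas, rule prems)+
  then show ?case by (simp add: split)
qed

section \<open>Dilations and Lebesgue measure\<close>

lemma product_sigma_finite_lborel: "product_sigma_finite (\<lambda>_::nat. lborel :: real measure)" ..

lemma sigma_finite_Rn_lborel: "sigma_finite_measure (Rn_lborel n)"
  unfolding Rn_lborel_def by (rule product_sigma_finite.sigma_finite[OF product_sigma_finite_lborel]) simp

lemma vscale_measurable [measurable]: "vscale n r \<in> measurable (Rn_lborel n) (Rn_lborel n)"
  unfolding vscale_def Rn_lborel_def by measurable

lemma emeasure_lborel_vimage_times:
  assumes "r \<noteq> 0" and [measurable]: "A \<in> sets borel"
  shows "emeasure lborel A = ennreal \<bar>r\<bar> * emeasure lborel ((\<lambda>x::real. r * x) -` A)"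
proof -
  have "emeasure lborel A = emeasure (density (distr lborel borel (\<lambda>x. r * x)) (\<lambda>_. ennreal \<bar>r\<bar>)) A"
    using lborel_real_affine[OF assms(1), of 0] by simp
  also have "\<dots> = ennreal \<bar>r\<bar> * emeasure (distr lborel borel (\<lambda>x. r * x)) A"
    by (subst emeasure_density) (auto simp: nn_integral_cmult_indicator)
  finally show ?thesis by (subst (asm) emeasure_distr) auto
qed

lemma Rn_lborel_vscale:
  assumes r: "r \<noteq> 0"
  shows "scale_measure (ennreal (\<bar>r\<bar> ^ n)) (distr (Rn_lborel n) (Rn_lborel n) (vscale n r)) = Rn_lborel n"
proof -
  interpret product_sigma_finite "\<lambda>_::nat. lborel :: real measure" by (rule product_sigma_finite_lborel)
  show ?thesis
    unfolding Rn_lborel_def[of n]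
  proof (rule PiM_eqI)
    fix A :: "nat \<Rightarrow> real set" assume A: "\<And>i. i \<in> {..<n} \<Longrightarrow> A i \<in> sets lborel"
    let ?M = "Pi\<^sub>M {..<n} (\<lambda>_. lborel :: real measure)"
    have meas: "Pi\<^sub>E {..<n} A \<in> sets ?M" using A by (intro sets_PiM_I_finite) auto
    have pre: "vscale n r -` Pi\<^sub>E {..<n} A \<inter> space ?M = Pi\<^sub>E {..<n} (\<lambda>i. (\<lambda>x. r * x) -` A i)"
      by (auto simp: vscale_def space_PiM PiE_iff)
    have A': "(\<lambda>x. r * x) -` A i \<in> sets lborel" if "i < n" for i
      using measurable_sets[of "\<lambda>x. r * x" lborel lborel "A i"] A[of i] that by simp
    have "emeasure (scale_measure (ennreal (\<bar>r\<bar> ^ n)) (distr ?M ?M (vscale n r))) (Pi\<^sub>E {..<n} A)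
       = ennreal (\<bar>r\<bar> ^ n) * emeasure ?M (vscale n r -` Pi\<^sub>E {..<n} A \<inter> space ?M)"
      using meas vscale_measurable[of n r] by (simp add: emeasure_distr Rn_lborel_def)
    also have "\<dots> = (\<Prod>i<n. ennreal \<bar>r\<bar>) * (\<Prod>i<n. emeasure lborel ((\<lambda>x. r * x) -` A i))"
      unfolding pre using A' by (subst emeasure_PiM) (auto simp: ennreal_power)
    also have "\<dots> = (\<Prod>i<n. emeasure lborel (A i))"
      unfolding prod.distrib[symmetric] 
      by (rule prod.cong) (use A r in \<open>auto simp: emeasure_lborel_vimage_times[symmetric]\<close>)
    finally show "emeasure (scale_measure (ennreal (\<bar>r\<bar> ^ n)) (distr ?M ?M (vscale n r))) (Pi\<^sub>E {..<n} A)
      = (\<Prod>i<n. emeasure lborel (A i))" .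
  qed auto
qed

lemma emeasure_Rn_lborel_vscale_vimage:
  assumes "r \<noteq> 0" "A \<in> sets (Rn_lborel n)"
  shows "emeasure (Rn_lborel n) A = ennreal (\<bar>r\<bar> ^ n) * emeasure (Rn_lborel n) (vscale n r -` A \<inter> Rn n)"
  using assms(2) by (subst Rn_lborel_vscale[OF assms(1), symmetric]) (simp add: emeasure_distr)

lemma vscale_vscale: "vscale n r (vscale n q x) = vscale n (r * q) x"
  by (auto simp: vscale_def)

lemma vscale_1: "x \<in> Rn n \<Longrightarrow> vscale n 1 x = x"
  by (auto simp: vscale_def Rn_def fun_eq_iff PiE_iff extensional_def)

lemma vscale_in_Rn [simp]: "vscale n r x \<in> Rn n"
  by (auto simp: vscale_def Rn_def)

lemma vadd_in_Rn [simp]: "vadd n x y \<in> Rn n"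
  by (auto simp: vadd_def Rn_def)

lemma in_vscale_image_iff:
  assumes "r > 0" "K \<subseteq> Rn n" "x \<in> Rn n"
  shows "x \<in> vscale n r ` K \<longleftrightarrow> vscale n (1 / r) x \<in> K"
proof
  assume "x \<in> vscale n r ` K"
  then obtain y where "y \<in> K" "x = vscale n r y" by blast
  then show "vscale n (1 / r) x \<in> K" using assms by (auto simp: vscale_vscale vscale_1 subset_iff)
next
  assume "vscale n (1 / r) x \<in> K"
  moreover have "vscale n r (vscale n (1 / r) x) = x" using assms by (simp add: vscale_vscale vscale_1)
  ultimately show "x \<in> vscale n r ` K" by (metis imageI)
qed

lemma vscale_image_eq_vimage:
  assumes "r > 0" "K \<subseteq> Rn n"
  shows "vscale n r ` K = vscale n (1 / r) -` K \<inter> Rn n"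
proof -
  have "vscale n r ` K \<subseteq> Rn n" by auto
  then show ?thesis using in_vscale_image_iff[OF assms] by blast
qed

lemma sets_vscale_image:
  assumes "r > 0" "K \<in> sets (Rn_lborel n)"
  shows "vscale n r ` K \<in> sets (Rn_lborel n)"
proof -
  have "K \<subseteq> Rn n" using sets.sets_into_space[OF assms(2)] by simp
  then show ?thesis
    using measurable_sets[OF vscale_measurable assms(2), of "1/r"] assms by (simp add: vscale_image_eq_vimage)
qed

lemma emeasure_vscale_image:
  assumes "r > 0" "K \<in> sets (Rn_lborel n)"
  shows "emeasure (Rn_lborel n) (vscale n r ` K) = ennreal (r ^ n) * emeasure (Rn_lborel n) K"
proof -
  have sub: "K \<subseteq> Rn n" using sets.sets_into_space[OF assms(2)] by simp
  have "ennreal (r ^ n) * emeasure (Rn_lborel n) K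
    = ennreal (r ^ n) * (ennreal (\<bar>1/r\<bar> ^ n) * emeasure (Rn_lborel n) (vscale n (1/r) -` K \<inter> Rn n))"
    using emeasure_Rn_lborel_vscale_vimage[of "1/r" K n] assms by simp
  also have "\<dots> = ennreal (r ^ n * (1/r) ^ n) * emeasure (Rn_lborel n) (vscale n (1/r) -` K \<inter> Rn n)"
    using assms by (simp add: ennreal_mult mult.assoc)
  also have "r ^ n * (1/r) ^ n = 1" using assms by (simp add: power_mult_distrib[symmetric])
  finally show ?thesis using assms sub by (simp add: vscale_image_eq_vimage)
qed

lemma distr_Rn_lborel_uminus: "distr (Rn_lborel n) (Rn_lborel n) (vscale n (-1)) = Rn_lborel n"
  using Rn_lborel_vscale[of "-1" n] by simp

section \<open>Measurability and boundedness of convex bodies\<close>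

text \<open>
  Extending by \<open>undefined\<close> embeds \<open>\<real>\<^sup>n\<close> measurably into the countable power of \<open>\<real>\<close>, where the product
  \<open>\<sigma>\<close>-algebra is known to be the Borel \<open>\<sigma>\<close>-algebra of the product topology.
\<close>

lemma sets_Rn_lborel_closedin:
  assumes "closedin (Rn_top n) K"
  shows "K \<in> sets (Rn_lborel n)"
proof -
  have "continuous_map (product_topology (\<lambda>_. euclideanreal) UNIV) (Rn_top n) (\<lambda>x. restrict x {..<n})"
    unfolding Rn_top_def
    by (auto simp: continuous_map_componentwise intro!: continuous_map_product_projection)
  then have "closedin (product_topology (\<lambda>_. euclideanreal) UNIV)
      {x \<in> topspace (product_topology (\<lambda>_. euclideanreal) UNIV). restrict x {..<n} \<in> K}"
    using assms by (rule closedin_continuous_map_preimage)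
  then have "closed {x::nat \<Rightarrow> real. restrict x {..<n} \<in> K}"
    by (simp add: euclidean_product_topology)
  then have meas: "{x::nat \<Rightarrow> real. restrict x {..<n} \<in> K} \<in> sets borel" by simp
  have "(\<lambda>x. x) \<in> measurable (Rn_lborel n) (borel :: (nat \<Rightarrow> real) measure)"
  proof (rule measurable_coordinatewise_then_product)
    fix i :: nat
    show "(\<lambda>x. x i) \<in> borel_measurable (Rn_lborel n)"
    proof (cases "i < n")
      case True
      then show ?thesis
        using measurable_component_singleton[of i "{..<n}" "\<lambda>_. lborel"] by (simp add: Rn_lborel_def)
    next
      case False
      then show ?thesis
        by (subst measurable_cong[where g = "\<lambda>_. undefined"]) (auto simp: Rn_def PiE_iff extensional_def)
    qed
  qed
  moreover have r: "restrict x {..<n} = x" if "x \<in> Rn n" for x :: "nat \<Rightarrow> real"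
    using that unfolding Rn_def by (rule PiE_restrict)
  ultimately have "(\<lambda>x. x) -` {x. restrict x {..<n} \<in> K} \<inter> space (Rn_lborel n) \<in> sets (Rn_lborel n)"
    using meas by (rule_tac measurable_sets)
  then have "(\<lambda>x. x) -` {x. restrict x {..<n} \<in> K} \<inter> Rn n \<in> sets (Rn_lborel n)" by simp
  also have "(\<lambda>x. x) -` {x. restrict x {..<n} \<in> K} \<inter> Rn n = K"
    using closedin_subset[OF assms] r by (auto simp: subset_iff)
  finally show ?thesis .
qed

lemma Hausdorff_Rn_top: "Hausdorff_space (Rn_top n)"
  unfolding Rn_top_def by (simp add: Hausdorff_space_product_topology)

lemma convex_body_subset: "convex_body n K \<Longrightarrow> K \<subseteq> Rn n"
  unfolding convex_body_def by (metis compactin_subset_topspace topspace_Rn_top)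

lemma convex_body_sets: "convex_body n K \<Longrightarrow> K \<in> sets (Rn_lborel n)"
  unfolding convex_body_def
  by (intro sets_Rn_lborel_closedin compactin_imp_closedin Hausdorff_Rn_top) auto

lemma convex_body_bounded:
  assumes "convex_body n K"
  obtains R where "R > 0" "\<And>x i. x \<in> K \<Longrightarrow> i < n \<Longrightarrow> \<bar>x i\<bar> \<le> R"
proof -
  have "\<exists>R. \<forall>x\<in>K. \<bar>x i\<bar> \<le> R" if "i < n" for i
  proof -
    have "continuous_map (Rn_top n) euclideanreal (\<lambda>x. x i)"
      unfolding Rn_top_def using that by (intro continuous_map_product_projection) auto
    then have "compactin euclideanreal ((\<lambda>x. x i) ` K)"
      using assms unfolding convex_body_def by (blast intro: image_compactin)
    then have "bounded ((\<lambda>x. x i) ` K)" by (simp add: compact_imp_bounded)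
    then show ?thesis by (auto simp: bounded_iff)
  qed
  then obtain R where R: "\<And>i x. i < n \<Longrightarrow> x \<in> K \<Longrightarrow> \<bar>x i\<bar> \<le> R i" by metis
  show ?thesis
  proof (rule that[of "1 + (\<Sum>i<n. \<bar>R i\<bar>)"])
    show "1 + (\<Sum>i<n. \<bar>R i\<bar>) > 0" by (simp add: add_pos_nonneg sum_nonneg)
    fix x i assume "x \<in> K" "i < n"
    then have "\<bar>x i\<bar> \<le> \<bar>R i\<bar>" using R by fastforce
    also have "\<dots> \<le> (\<Sum>i<n. \<bar>R i\<bar>)" using \<open>i < n\<close> by (intro member_le_sum) auto
    finally show "\<bar>x i\<bar> \<le> 1 + (\<Sum>i<n. \<bar>R i\<bar>)" by simp
  qed
qed

lemma convex_body_emeasure_finite: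
  assumes "convex_body n K"
  shows "emeasure (Rn_lborel n) K < \<infinity>"
proof -
  interpret product_sigma_finite "\<lambda>_::nat. lborel :: real measure" by (rule product_sigma_finite_lborel)
  obtain R where R: "R > 0" "\<And>x i. x \<in> K \<Longrightarrow> i < n \<Longrightarrow> \<bar>x i\<bar> \<le> R"
    using convex_body_bounded[OF assms] by blast
  have "K \<subseteq> ({..<n} \<rightarrow>\<^sub>E {-R..R})"
  proof
    fix x assume x: "x \<in> K"
    then have "x \<in> Rn n" using convex_body_subset[OF assms] by blast
    moreover have "x i \<in> {-R..R}" if "i < n" for i using R(2)[OF x that] by (simp add: abs_le_iff)
    ultimately show "x \<in> ({..<n} \<rightarrow>\<^sub>E {-R..R})" by (simp add: Rn_def PiE_iff)
  qed
  then have "emeasure (Rn_lborel n) K \<le> emeasure (Rn_lborel n) ({..<n} \<rightarrow>\<^sub>E {-R..R})"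
    unfolding Rn_lborel_def by (intro emeasure_mono sets_PiM_I_finite) auto
  also have "\<dots> = (\<Prod>i<n. ennreal (2 * R))"
    unfolding Rn_lborel_def using R by (subst emeasure_PiM) auto
  also have "\<dots> = ennreal ((2 * R) ^ n)" using R(1) by (simp add: ennreal_power)
  also have "\<dots> < \<infinity>" by simp
  finally show ?thesis .
qed

lemma openin_Rn_top_box:
  assumes "openin (Rn_top n) U" "x \<in> U"
  shows "\<exists>r>0. \<forall>y\<in>Rn n. (\<forall>i<n. \<bar>y i - x i\<bar> < r) \<longrightarrow> y \<in> U"
proof -
  obtain V where V: "\<And>i. i < n \<Longrightarrow> open (V i)" "x \<in> Pi\<^sub>E {..<n} V" "Pi\<^sub>E {..<n} V \<subseteq> U"
    using bspec[OF assms(1)[unfolded Rn_top_def openin_product_topology_alt] assms(2)] by auto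
  have "\<exists>e>0. \<forall>y. dist y (x i) < e \<longrightarrow> y \<in> V i" if "i < n" for i
    using V that by (auto simp: open_dist PiE_iff)
  then obtain e where e: "\<And>i. i < n \<Longrightarrow> e i > 0" "\<And>i y. i < n \<Longrightarrow> dist y (x i) < e i \<Longrightarrow> y \<in> V i"
    by metis
  define r where "r = Min (insert 1 (e ` {..<n}))"
  have r: "r > 0" "\<And>i. i < n \<Longrightarrow> r \<le> e i" using e by (auto simp: r_def)
  show ?thesis
  proof (intro exI[of _ r] conjI ballI impI)
    show "r > 0" by (rule r(1))
    fix y assume y: "y \<in> Rn n" and "\<forall>i<n. \<bar>y i - x i\<bar> < r"
    then have y2: "\<bar>y i - x i\<bar> < r" if "i < n" for i using that by simp
    have "y i \<in> V i" if "i < n" for i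
      using e(2)[OF that] y2[OF that] r(2)[OF that] by (simp add: dist_real_def)
    then have "y \<in> Pi\<^sub>E {..<n} V" using y by (auto simp: Rn_def PiE_iff)
    then show "y \<in> U" using V by auto
  qed
qed

lemma symmetric_uminus_in:
  assumes "centrally_symmetric n K" "x \<in> K"
  shows "vscale n (-1) x \<in> K"
  using assms unfolding centrally_symmetric_def by blast

text \<open>
  If \<open>p\<close> is an interior point, then \<open>x\<close> is the midpoint of \<open>p + x\<close> and \<open>-(p - x)\<close>.
\<close>

lemma symmetric_convex_body_box:
  assumes "convex_body n K" "centrally_symmetric n K"
  shows "\<exists>r>0. \<forall>x\<in>Rn n. (\<forall>i<n. \<bar>x i\<bar> < r) \<longrightarrow> x \<in> K"
proof -
  have conv: "vconvex n K" and ne: "Rn_top n interior_of K \<noteq> {}"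
    using assms by (auto simp: convex_body_def)
  obtain p where p: "p \<in> Rn_top n interior_of K" using ne by blast
  obtain r where r: "r > 0" "\<forall>y\<in>Rn n. (\<forall>i<n. \<bar>y i - p i\<bar> < r) \<longrightarrow> y \<in> Rn_top n interior_of K"
    using openin_Rn_top_box[OF openin_interior_of p] by auto
  have in_K: "y \<in> K" if "y \<in> Rn n" "\<forall>i<n. \<bar>y i - p i\<bar> < r" for y
    using r(2) that interior_of_subset[of "Rn_top n" K] by auto
  show ?thesis
  proof (intro exI[of _ r] conjI ballI impI)
    show "r > 0" by (rule r(1))
    fix x assume x: "x \<in> Rn n" "\<forall>i<n. \<bar>x i\<bar> < r"
    have 1: "vadd n p x \<in> K" by (rule in_K) (use x in \<open>auto simp: vadd_def Rn_def\<close>)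
    have "vsub n p x \<in> K"
      by (rule in_K) (use x in \<open>auto simp: vsub_def Rn_def\<close>)
    then have 2: "vscale n (-1) (vsub n p x) \<in> K" by (rule symmetric_uminus_in[OF assms(2)])
    have "vadd n (vscale n (1/2) (vadd n p x)) (vscale n (1/2) (vscale n (-1) (vsub n p x))) \<in> K"
      using conv[unfolded vconvex_def, rule_format, OF 1 2, of "1/2" "1/2"] by simp
    also have "vadd n (vscale n (1/2) (vadd n p x)) (vscale n (1/2) (vscale n (-1) (vsub n p x))) = x"
    proof
      fix i show "vadd n (vscale n (1/2) (vadd n p x)) (vscale n (1/2) (vscale n (-1) (vsub n p x))) i = x i"
        using x(1) by (cases "i < n") (auto simp: vadd_def vsub_def vscale_def Rn_def PiE_iff extensional_def field_simps)
    qed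
    finally show "x \<in> K" .
  qed
qed

lemma set_integrable_convex_body:
  assumes "convex_body n K" and f[measurable]: "f \<in> borel_measurable (Rn_lborel n)"
    and "\<And>x. x \<in> K \<Longrightarrow> \<bar>f x :: real\<bar> \<le> B"
  shows "set_integrable (Rn_lborel n) K f"
proof -
  have [measurable]: "K \<in> sets (Rn_lborel n)" using assms by (simp add: convex_body_sets)
  show ?thesis unfolding set_integrable_def
  proof (rule Bochner_Integration.integrable_bound[of _ "\<lambda>x. B * indicator K x"])
    show "integrable (Rn_lborel n) (\<lambda>x. B * indicator K x)"
      using convex_body_emeasure_finite[OF assms(1)] by (intro integrable_mult_right integrable_real_indicator) auto
    show "AE x in Rn_lborel n. norm (indicat_real K x *\<^sub>R f x) \<le> norm (B * indicator K x)"
      using assms(3) by (auto simp: indicator_def intro: order.trans[OF _ abs_ge_self])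
  qed measurable
qed

section \<open>Concentration for 2-convex bodies\<close>

lemma brunn_minkowski_multiplicative:
  assumes [measurable]: "A \<in> sets (Rn_lborel n)" "B \<in> sets (Rn_lborel n)" "H \<in> sets (Rn_lborel n)"
    and mid: "\<And>x y. x \<in> A \<Longrightarrow> y \<in> B \<Longrightarrow> vscale n (1/2) (vadd n x y) \<in> H"
  shows "emeasure (Rn_lborel n) A * emeasure (Rn_lborel n) B \<le> (emeasure (Rn_lborel n) H)\<^sup>2"
proof -
  have "(\<integral>\<^sup>+x. indicator A x \<partial>Rn_lborel n) * (\<integral>\<^sup>+x. indicator B x \<partial>Rn_lborel n)
      \<le> (\<integral>\<^sup>+x. indicator H x \<partial>Rn_lborel n)\<^sup>2"
    by (rule prekopa_leindler) (use mid in \<open>auto simp: indicator_def\<close>)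
  then show ?thesis by simp
qed

lemma vinner_measurable [measurable]: "(\<lambda>x. vinner n x \<xi>) \<in> borel_measurable (Rn_lborel n)"
  unfolding vinner_def Rn_lborel_def by measurable

lemma vinner_vscale [simp]: "vinner n (vscale n r x) \<xi> = r * vinner n x \<xi>"
  by (simp add: vinner_def vscale_def sum_distrib_left mult.assoc)

lemma vinner_vadd [simp]: "vinner n (vadd n x y) \<xi> = vinner n x \<xi> + vinner n y \<xi>"
  by (simp add: vinner_def vadd_def distrib_right sum.distrib)

lemma vinner_vsub [simp]: "vinner n (vsub n x y) \<xi> = vinner n x \<xi> - vinner n y \<xi>"
  by (simp add: vinner_def vsub_def left_diff_distrib sum_subtractf)

lemma vsub_in_Rn [simp]: "vsub n x y \<in> Rn n"
  by (auto simp: vsub_def Rn_def)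

locale symmetric_body =
  fixes n :: nat and K :: "(nat \<Rightarrow> real) set"
  assumes body: "convex_body n K" and sym: "centrally_symmetric n K"
begin

lemma K_subset: "K \<subseteq> Rn n" by (rule convex_body_subset[OF body])

lemma in_Rn: "x \<in> K \<Longrightarrow> x \<in> Rn n" using K_subset by blast

lemma K_sets [measurable]: "K \<in> sets (Rn_lborel n)" by (rule convex_body_sets[OF body])

lemma convexD: "x \<in> K \<Longrightarrow> y \<in> K \<Longrightarrow> 0 \<le> u \<Longrightarrow> 0 \<le> v \<Longrightarrow> u + v = 1 \<Longrightarrow> vadd n (vscale n u x) (vscale n v y) \<in> K"
  using body unfolding convex_body_def vconvex_def by blast

lemma uminus_in: "x \<in> K \<Longrightarrow> vscale n (-1) x \<in> K"
  by (rule symmetric_uminus_in[OF sym])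

text \<open>
  The point \<open>u x\<close> is a convex combination of \<open>x\<close> and \<open>-x\<close>.
\<close>

lemma shrink_in:
  assumes "x \<in> K" "0 \<le> u" "u \<le> 1"
  shows "vscale n u x \<in> K"
proof -
  have "vadd n (vscale n ((1 + u) / 2) x) (vscale n ((1 - u) / 2) (vscale n (-1) x)) \<in> K"
    by (rule convexD) (use assms uminus_in in \<open>auto simp: field_simps\<close>)
  also have "vadd n (vscale n ((1 + u) / 2) x) (vscale n ((1 - u) / 2) (vscale n (-1) x)) = vscale n u x"
    by (auto simp: vadd_def vscale_def fun_eq_iff field_simps)
  finally show ?thesis .
qed

lemma midpoint_in: "x \<in> K \<Longrightarrow> y \<in> K \<Longrightarrow> vscale n (1/2) (vadd n x y) \<in> K"
proof -
  assume "x \<in> K" "y \<in> K"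
  then have "vadd n (vscale n (1/2) x) (vscale n (1/2) y) \<in> K" by (intro convexD) auto
  also have "vadd n (vscale n (1/2) x) (vscale n (1/2) y) = vscale n (1/2) (vadd n x y)"
    by (auto simp: vadd_def vscale_def fun_eq_iff field_simps)
  finally show ?thesis .
qed

lemma dilate_mono:
  assumes "0 < r" "r \<le> q" "x \<in> vscale n r ` K"
  shows "x \<in> vscale n q ` K"
proof -
  obtain y where y: "y \<in> K" "x = vscale n r y" using assms by blast
  have "x = vscale n q (vscale n (r / q) y)" using assms y by (simp add: vscale_vscale)
  moreover have "vscale n (r / q) y \<in> K" using assms y by (intro shrink_in) auto
  ultimately show ?thesis by blast
qed

lemma absorbing:
  assumes "x \<in> Rn n"
  shows "\<exists>r>0. x \<in> vscale n r ` K"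
proof -
  obtain e where e: "e > 0" "\<forall>x\<in>Rn n. (\<forall>i<n. \<bar>x i\<bar> < e) \<longrightarrow> x \<in> K"
    using symmetric_convex_body_box[OF body sym] by blast
  define q where "q = (1 + (\<Sum>i<n. \<bar>x i\<bar>)) / e"
  have pos: "1 + (\<Sum>i<n. \<bar>x i\<bar>) > 0" by (simp add: add_pos_nonneg sum_nonneg)
  have q: "q > 0" using e pos by (simp add: q_def)
  have "vscale n (1 / q) x \<in> K"
  proof (rule e(2)[rule_format])
    fix i assume i: "i < n"
    have "\<bar>x i\<bar> \<le> (\<Sum>i<n. \<bar>x i\<bar>)" using i by (intro member_le_sum) auto
    then have "\<bar>x i\<bar> < q * e" using e by (simp add: q_def)
    then show "\<bar>vscale n (1 / q) x i\<bar> < e"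
      using q i by (simp add: vscale_def abs_mult field_simps)
  qed simp
  then show ?thesis using q in_vscale_image_iff[OF q K_subset assms] by blast
qed

lemma body_norm_le:
  assumes "r > 0" "x \<in> vscale n r ` K"
  shows "body_norm n K x \<le> r"
  unfolding body_norm_def by (rule cInf_lower) (use assms in \<open>auto intro!: bdd_belowI[of _ 0]\<close>)

lemma body_norm_ge:
  assumes "x \<in> Rn n" "\<And>r. r > 0 \<Longrightarrow> x \<in> vscale n r ` K \<Longrightarrow> b \<le> r"
  shows "b \<le> body_norm n K x"
  unfolding body_norm_def by (rule cInf_greatest) (use absorbing[OF assms(1)] assms(2) in auto)

lemma body_norm_nonneg: "x \<in> Rn n \<Longrightarrow> 0 \<le> body_norm n K x"
  by (rule body_norm_ge) auto

lemma in_dilate_of_body_norm_less: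
  assumes "x \<in> Rn n" "body_norm n K x < q"
  shows "x \<in> vscale n q ` K"
proof (rule ccontr)
  assume *: "x \<notin> vscale n q ` K"
  have "q \<le> body_norm n K x"
  proof (rule body_norm_ge[OF assms(1)])
    fix r assume "r > 0" "x \<in> vscale n r ` K"
    then show "q \<le> r" using dilate_mono[of r q x] * by (cases "r \<le> q") auto
  qed
  then show False using assms by simp
qed

lemma body_norm_le_1: "x \<in> K \<Longrightarrow> body_norm n K x \<le> 1"
  by (rule body_norm_le) (auto simp: image_iff vscale_1 in_Rn intro!: bexI[of _ x])

lemma vinner_le_body_norm:
  assumes "w \<in> Rn n" "0 < h" "\<And>x. x \<in> K \<Longrightarrow> vinner n x \<xi> \<le> h"
  shows "vinner n w \<xi> / h \<le> body_norm n K w"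
proof (rule body_norm_ge[OF assms(1)])
  fix r assume "r > 0" "w \<in> vscale n r ` K"
  then show "vinner n w \<xi> / h \<le> r" using assms by (auto simp: divide_le_eq)
qed

text \<open>
  The lower bound on an infimum of real numbers says something about its members only if these are
  bounded below.  They are: a point of norm at most \<open>1\<close> lies in \<open>2 K\<close>, hence so do the midpoints.
\<close>

lemma two_convex_midpoint:
  assumes "two_convex n K \<alpha>" "0 < \<epsilon>" "\<epsilon> \<le> 2" "x \<in> K" "y \<in> K" "\<epsilon> \<le> body_norm n K (vsub n x y)"
  shows "body_norm n K (vscale n (1/2) (vadd n x y)) \<le> 1 - \<alpha> * \<epsilon>\<^sup>2"
proof -
  let ?S = "{1 - body_norm n K (vscale n (1/2) (vadd n x y)) | x y.
          x \<in> Rn n \<and> y \<in> Rn n \<and> body_norm n K x \<le> 1 \<and> body_norm n K y \<le> 1 \<and>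
          body_norm n K (vsub n x y) \<ge> \<epsilon>}"
  have "bdd_below ?S"
  proof (rule bdd_belowI[of _ "-1"], clarify)
    fix x y assume "x \<in> Rn n" "y \<in> Rn n" "body_norm n K x \<le> 1" "body_norm n K y \<le> 1"
    then have "x \<in> vscale n 2 ` K" "y \<in> vscale n 2 ` K" by (auto intro!: in_dilate_of_body_norm_less)
    then obtain x' y' where xy: "x' \<in> K" "y' \<in> K" "x = vscale n 2 x'" "y = vscale n 2 y'" by blast
    have "vscale n (1/2) (vadd n x y) = vscale n 2 (vscale n (1/2) (vadd n x' y'))"
      by (auto simp: xy vscale_def vadd_def fun_eq_iff)
    then have "vscale n (1/2) (vadd n x y) \<in> vscale n 2 ` K" using midpoint_in xy by blast
    then show "- 1 \<le> 1 - body_norm n K (vscale n (1/2) (vadd n x y))"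
      using body_norm_le[of 2] by fastforce
  qed
  then have "modulus_of_convexity n K \<epsilon> \<le> 1 - body_norm n K (vscale n (1/2) (vadd n x y))"
    unfolding modulus_of_convexity_def
    by (rule cInf_lower[rotated]) (use assms body_norm_le_1 in_Rn in blast)
  moreover have "\<alpha> * \<epsilon>\<^sup>2 \<le> modulus_of_convexity n K \<epsilon>"
    using assms(1-3) by (auto simp: two_convex_def)
  ultimately show ?thesis by simp
qed

lemma halfspace_sets: "{x \<in> K. vinner n x \<xi> \<le> 0} \<in> sets (Rn_lborel n)"
proof -
  have "{x \<in> space (Rn_lborel n). vinner n x \<xi> \<le> 0} \<in> sets (Rn_lborel n)" by measurable
  then have "K \<inter> {x \<in> space (Rn_lborel n). vinner n x \<xi> \<le> 0} \<in> sets (Rn_lborel n)" by (rule sets.Int[OF K_sets])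
  also have "K \<inter> {x \<in> space (Rn_lborel n). vinner n x \<xi> \<le> 0} = {x \<in> K. vinner n x \<xi> \<le> 0}"
    using K_subset by auto
  finally show ?thesis .
qed

text \<open>
  The half of \<open>K\<close> and its reflection cover \<open>K\<close>.
\<close>

lemma emeasure_halfspace_ge:
  "emeasure (Rn_lborel n) K \<le> 2 * emeasure (Rn_lborel n) {x \<in> K. vinner n x \<xi> \<le> 0}" (is "_ \<le> 2 * emeasure _ ?A")
proof -
  have A: "?A \<in> sets (Rn_lborel n)" by (rule halfspace_sets)
  have B: "vscale n (-1) -` ?A \<inter> Rn n \<in> sets (Rn_lborel n)"
    using measurable_sets[OF vscale_measurable A, of "-1"] unfolding space_Rn_lborel .
  have "K \<subseteq> ?A \<union> (vscale n (-1) -` ?A \<inter> Rn n)"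
    using uminus_in K_subset by auto
  then have "emeasure (Rn_lborel n) K \<le> emeasure (Rn_lborel n) (?A \<union> (vscale n (-1) -` ?A \<inter> Rn n))"
    using A B by (intro emeasure_mono) auto
  also have "\<dots> \<le> emeasure (Rn_lborel n) ?A + emeasure (Rn_lborel n) (vscale n (-1) -` ?A \<inter> Rn n)"
    using A B by (intro emeasure_subadditive) auto
  also have "emeasure (Rn_lborel n) (vscale n (-1) -` ?A \<inter> Rn n) = emeasure (Rn_lborel n) ?A"
    using emeasure_Rn_lborel_vscale_vimage[OF _ A, of "-1"] by simp
  finally show ?thesis by (simp add: mult_2)
qed

text \<open>
  The concentration argument: midpoints of \<open>B\<close> and of the half \<open>\<langle>y,\<xi>\<rangle> \<le> 0\<close> of \<open>K\<close> lie in
  \<open>exp (-\<alpha> \<epsilon>\<^sup>2) K\<close>, whose volume is \<open>exp (-n \<alpha> \<epsilon>\<^sup>2) |K|\<close>.  The bound \<open>1 - \<alpha> \<epsilon>\<^sup>2 < exp (-\<alpha> \<epsilon>\<^sup>2)\<close> is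
  strict for \<open>\<epsilon> > 0\<close>; since the norm is an infimum, it is the strict inequality that puts the midpoint into the
  dilate.
\<close>

lemma two_convex_tail:
  assumes tc: "two_convex n K \<alpha>" and \<alpha>: "0 < \<alpha>" and h: "0 < h" "\<And>x. x \<in> K \<Longrightarrow> vinner n x \<xi> \<le> h"
    and \<epsilon>: "0 \<le> \<epsilon>" and B[measurable]: "B \<in> sets (Rn_lborel n)" "B \<subseteq> K" "\<And>x. x \<in> B \<Longrightarrow> \<epsilon> * h < vinner n x \<xi>"
  shows "measure (Rn_lborel n) B \<le> 2 * exp (- 2 * \<alpha> * real n * \<epsilon>\<^sup>2) * vol n K"
proof -
  let ?M = "Rn_lborel n"
  let ?A = "{x \<in> K. vinner n x \<xi> \<le> 0}"
  let ?\<rho> = "exp (- \<alpha> * \<epsilon>\<^sup>2)"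
  have A: "?A \<in> sets ?M" by (rule halfspace_sets)
  have fin: "emeasure ?M S \<noteq> \<infinity>" if "S \<subseteq> K" for S
    using emeasure_mono[OF that K_sets] convex_body_emeasure_finite[OF body] by (auto simp: top_unique)
  have eq: "emeasure ?M S = ennreal (measure ?M S)" if "S \<subseteq> K" for S
    using fin[OF that] by (simp add: emeasure_eq_ennreal_measure)
  have mid: "vscale n (1/2) (vadd n x y) \<in> vscale n ?\<rho> ` K" if x: "x \<in> B" and y: "y \<in> ?A" for x y
  proof (cases "\<epsilon> = 0")
    case True
    have "vscale n (1/2) (vadd n x y) \<in> K" using that B by (intro midpoint_in) auto
    then show ?thesis using True by (auto simp: image_iff vscale_1 intro!: bexI[of _ "vscale n (1/2) (vadd n x y)"])
  next
    case False
    have "\<epsilon> * h < h" using B(3)[OF x] h(2)[of x] x B(2) by fastforce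
    then have e1: "\<epsilon> < 1" using h by simp
    have "\<epsilon> \<le> vinner n (vsub n x y) \<xi> / h"
      using B(3)[OF x] y h by (simp add: le_divide_eq)
    also have "\<dots> \<le> body_norm n K (vsub n x y)" by (rule vinner_le_body_norm) (use h in auto)
    finally have "body_norm n K (vscale n (1/2) (vadd n x y)) \<le> 1 - \<alpha> * \<epsilon>\<^sup>2"
      using that B False \<epsilon> e1 by (intro two_convex_midpoint[OF tc]) auto
    also have "\<dots> < ?\<rho>"
      using exp_minus_greater[of "\<alpha> * \<epsilon>\<^sup>2"] False \<alpha> by simp
    finally show ?thesis by (intro in_dilate_of_body_norm_less) auto
  qed
  have "emeasure ?M B * emeasure ?M ?A \<le> (emeasure ?M (vscale n ?\<rho> ` K))\<^sup>2"
    by (rule brunn_minkowski_multiplicative) (use mid A sets_vscale_image in auto)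
  also have "emeasure ?M (vscale n ?\<rho> ` K) = ennreal (?\<rho> ^ n) * emeasure ?M K"
    by (rule emeasure_vscale_image) auto
  also have "\<dots> = ennreal (?\<rho> ^ n * measure ?M K)" by (simp add: eq ennreal_mult)
  also have "(ennreal (?\<rho> ^ n * measure ?M K))\<^sup>2 = ennreal ((?\<rho> ^ n * measure ?M K)\<^sup>2)"
    by (rule ennreal_power) simp
  also have "emeasure ?M B * emeasure ?M ?A = ennreal (measure ?M B * measure ?M ?A)"
    using B(2) by (simp add: eq ennreal_mult)
  finally have "ennreal (measure ?M B * measure ?M ?A) \<le> ennreal ((?\<rho> ^ n * measure ?M K)\<^sup>2)" .
  then have BA: "measure ?M B * measure ?M ?A \<le> (?\<rho> ^ n * measure ?M K)\<^sup>2"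
    by (subst (asm) ennreal_le_iff) auto
  have "ennreal (measure ?M K) \<le> ennreal (2 * measure ?M ?A)"
    using emeasure_halfspace_ge[of \<xi>] by (simp add: eq ennreal_mult)
  then have half: "measure ?M K \<le> 2 * measure ?M ?A" by (subst (asm) ennreal_le_iff) auto
  have "ennreal (measure ?M B) \<le> ennreal (measure ?M K)"
    using emeasure_mono[OF B(2) K_sets] B(2) by (simp add: eq)
  then have BK: "measure ?M B \<le> measure ?M K" by simp
  have "measure ?M B * measure ?M K \<le> 2 * (?\<rho> ^ n * measure ?M K)\<^sup>2"
    using mult_left_mono[OF half, of "measure ?M B"] BA by simp
  also have "\<dots> = (2 * exp (- 2 * \<alpha> * real n * \<epsilon>\<^sup>2) * measure ?M K) * measure ?M K"
    by (simp add: power2_eq_square exp_of_nat_mult[symmetric] exp_add[symmetric] mult_ac flip: exp_add)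
  finally show ?thesis
    using BK by (cases "measure ?M K = 0") (auto simp: vol_def zero_less_measure_iff)
qed

text \<open>
  Layer-cake integration of the tail bound with \<open>\<epsilon> = \<surd>t\<close> gives \<open>|K| / (\<alpha> n)\<close> for the positive part of
  \<open>\<langle>x,\<xi>\<rangle> / h\<close>; the negative part contributes the same by symmetry.
\<close>

lemma two_convex_second_moment:
  assumes tc: "two_convex n K \<alpha>" and \<alpha>: "0 < \<alpha>" and n: "n \<ge> 1"
    and h: "0 < h" "\<And>x. x \<in> K \<Longrightarrow> vinner n x \<xi> \<le> h"
  shows "\<alpha> * real n * (LINT x:K|Rn_lborel n. (vinner n x \<xi>)\<^sup>2) \<le> 2 * h\<^sup>2 * vol n K"
proof -
  let ?M = "Rn_lborel n"
  define f where "f x = indicator K x * (max (vinner n x \<xi>) 0 / h)\<^sup>2" for x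
  have f[measurable]: "f \<in> borel_measurable ?M" unfolding f_def by measurable
  have f0: "0 \<le> f x" for x by (simp add: f_def)
  have tail: "emeasure ?M {x \<in> space ?M. t < f x} \<le> ennreal (2 * vol n K * exp (- (2 * \<alpha> * real n) * t))" if t: "0 \<le> t" for t
  proof -
    let ?B = "{x \<in> space ?M. t < f x}"
    have Bm: "?B \<in> sets ?M" by measurable
    have BK: "?B \<subseteq> K" using t by (auto simp: f_def indicator_def split: if_splits)
    have "sqrt t * h < vinner n x \<xi>" if x: "x \<in> ?B" for x
    proof -
      have "x \<in> K" using x BK by blast
      then have "t < (max (vinner n x \<xi>) 0 / h)\<^sup>2" using x by (simp add: f_def)
      then have "sqrt t < max (vinner n x \<xi>) 0 / h" using h(1) by (intro real_less_lsqrt) auto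
      then have "sqrt t * h < max (vinner n x \<xi>) 0" using h by (simp add: less_divide_eq)
      moreover have "0 \<le> sqrt t * h" using t h by simp
      ultimately show ?thesis by linarith
    qed
    then have "measure ?M ?B \<le> 2 * exp (- 2 * \<alpha> * real n * (sqrt t)\<^sup>2) * vol n K"
      using t by (intro two_convex_tail[OF tc \<alpha> h _ Bm BK]) auto
    moreover have "emeasure ?M ?B \<noteq> \<infinity>"
      using emeasure_mono[OF BK K_sets] convex_body_emeasure_finite[OF body] by (auto simp: top_unique)
    ultimately show ?thesis using t
      by (simp add: emeasure_eq_ennreal_measure mult_ac ennreal_leI)
  qed
  let ?c = "vol n K / (\<alpha> * real n)"
  have np: "\<alpha> * real n > 0" using n \<alpha> by simp
  have "(\<integral>\<^sup>+x. ennreal (f x) \<partial>?M) = (\<integral>\<^sup>+t. emeasure ?M {x \<in> space ?M. t < f x} * indicator {0..} t \<partial>lborel)"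
    by (rule nn_integral_layer_cake[OF sigma_finite_Rn_lborel f f0])
  also have "\<dots> \<le> (\<integral>\<^sup>+t. ennreal (2 * vol n K * exp (- (2 * \<alpha> * real n) * t)) * indicator {0..} t \<partial>lborel)"
    by (rule nn_integral_mono) (use tail in \<open>auto simp: indicator_def\<close>)
  also have "\<dots> = ennreal (0 - (- ?c * exp (- (2 * \<alpha> * real n) * 0)))"
  proof (rule nn_integral_FTC_atLeast[where F = "\<lambda>t. - ?c * exp (- (2 * \<alpha> * real n) * t)"])
    show "((\<lambda>t. - ?c * exp (- (2 * \<alpha> * real n) * t)) has_real_derivative 2 * vol n K * exp (- (2 * \<alpha> * real n) * t)) (at t)" for t
      using np n \<alpha> by (auto intro!: derivative_eq_intros simp: field_simps)
    have "((\<lambda>t. exp (- (2 * \<alpha> * real n) * t)) \<longlongrightarrow> 0) at_top"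
      using np by (intro filterlim_compose[OF exp_at_bot] filterlim_tendsto_neg_mult_at_bot[OF tendsto_const]) (auto simp: filterlim_ident)
    then show "((\<lambda>t. - ?c * exp (- (2 * \<alpha> * real n) * t)) \<longlongrightarrow> 0) at_top"
      by (intro tendsto_mult_right_zero)
  qed (auto simp: vol_def)
  also have "\<dots> = ennreal ?c" by simp
  finally have I1: "(\<integral>\<^sup>+x. ennreal (f x) \<partial>?M) \<le> ennreal ?c" .
  have "(\<integral>\<^sup>+x. ennreal (f x) \<partial>?M) = (\<integral>\<^sup>+x. ennreal (f x) \<partial>distr ?M ?M (vscale n (-1)))"
    by (simp add: distr_Rn_lborel_uminus)
  also have "\<dots> = (\<integral>\<^sup>+x. ennreal (f (vscale n (-1) x)) \<partial>?M)"
    by (rule nn_integral_distr) auto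
  finally have I2: "(\<integral>\<^sup>+x. ennreal (f (vscale n (-1) x)) \<partial>?M) = (\<integral>\<^sup>+x. ennreal (f x) \<partial>?M)" by simp
  have split: "indicator K x * (vinner n x \<xi>)\<^sup>2 = h\<^sup>2 * (f x + f (vscale n (-1) x))" if "x \<in> Rn n" for x
  proof -
    have "vscale n (-1) x \<in> K \<longleftrightarrow> x \<in> K"
      using uminus_in[of "vscale n (-1) x"] uminus_in[of x] that by (auto simp: vscale_vscale vscale_1)
    then show ?thesis using h by (auto simp: f_def indicator_def max_def power_divide)
  qed
  have "(\<integral>\<^sup>+x. ennreal (indicator K x * (vinner n x \<xi>)\<^sup>2) \<partial>?M)
      = (\<integral>\<^sup>+x. ennreal (h\<^sup>2) * (ennreal (f x) + ennreal (f (vscale n (-1) x))) \<partial>?M)"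
    by (rule nn_integral_cong) (use f0 in \<open>simp add: split ennreal_mult\<close>)
  also have "\<dots> = ennreal (h\<^sup>2) * ((\<integral>\<^sup>+x. ennreal (f x) \<partial>?M) + (\<integral>\<^sup>+x. ennreal (f (vscale n (-1) x)) \<partial>?M))"
    by (simp add: nn_integral_cmult nn_integral_add)
  also have "\<dots> \<le> ennreal (h\<^sup>2) * (ennreal ?c + ennreal ?c)"
    unfolding I2 by (intro mult_left_mono add_mono I1) auto
  also have "\<dots> = ennreal (h\<^sup>2 * (?c + ?c))"
  proof -
    have "0 \<le> ?c" using np by (simp add: vol_def)
    then show ?thesis by (simp only: ennreal_mult ennreal_plus add_nonneg_nonneg zero_le_power2)
  qed
  finally have "(LINT x:K|?M. (vinner n x \<xi>)\<^sup>2) \<le> h\<^sup>2 * (?c + ?c)"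
    unfolding set_lebesgue_integral_def using np
    by (subst integral_eq_nn_integral) (auto intro!: enn2real_leI simp: vol_def)
  then show ?thesis using np by (simp add: field_simps)
qed

end

section \<open>Separation and second moments of random combinations\<close>

lemma vlincomb_in_Rn [simp]: "vlincomb n s t x \<in> Rn n"
  by (auto simp: vlincomb_def Rn_def)

lemma vinner_vlincomb: "vinner n (vlincomb n s t x) \<xi> = (\<Sum>j<s. t j * vinner n (x j) \<xi>)"
  unfolding vinner_def vlincomb_def
  by (simp add: sum_distrib_left sum_distrib_right mult.assoc) (rule sum.swap)

lemma vinner_sum_right: "vinner n x (\<lambda>i. \<Sum>k\<in>I. a k * v k i) = (\<Sum>k\<in>I. a k * vinner n x (v k))"
  unfolding vinner_def
  by (simp add: sum_distrib_left mult.left_commute) (rule sum.swap)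

text \<open>
  Let \<open>z\<close> be the point of \<open>K\<close> nearest to \<open>y\<close>; the functional is \<open>y - z\<close>.  A point \<open>x\<close> of \<open>K\<close> beyond
  the hyperplane through \<open>z\<close> would make a short step from \<open>z\<close> towards \<open>x\<close> decrease the distance to \<open>y\<close>.
\<close>

lemma convex_body_separation:
  assumes body: "convex_body n K" and y: "y \<in> Rn n" "y \<notin> K"
  shows "\<exists>\<xi> b. (\<forall>x\<in>K. vinner n x \<xi> \<le> b) \<and> b < vinner n y \<xi>"
proof -
  define D where "D x = (\<Sum>i<n. (x i - y i)\<^sup>2)" for x :: "nat \<Rightarrow> real"
  have "continuous_map (Rn_top n) euclideanreal D"
    unfolding D_def Rn_top_def power2_eq_square
    by (intro continuous_map_sum continuous_map_real_mult continuous_map_diff continuous_map_product_projection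
        continuous_map_const[THEN iffD2]) auto
  then have "compactin euclideanreal (D ` K)"
    using body unfolding convex_body_def by (blast intro: image_compactin)
  then have "compact (D ` K)" by simp
  moreover have "K \<noteq> {}" using body interior_of_subset[of "Rn_top n" K] unfolding convex_body_def by blast
  ultimately obtain z where z: "z \<in> K" "\<And>x. x \<in> K \<Longrightarrow> D z \<le> D x"
    using compact_attains_inf[of "D ` K"] by auto
  define \<xi> where "\<xi> i = y i - z i" for i
  have "vinner n x \<xi> \<le> vinner n z \<xi>" if x: "x \<in> K" for x
  proof (rule ccontr)
    assume gt: "\<not> vinner n x \<xi> \<le> vinner n z \<xi>"
    define p where "p = vinner n x \<xi> - vinner n z \<xi>"
    define Q where "Q = (\<Sum>i<n. (x i - z i)\<^sup>2)"
    have p: "p > 0" using gt by (simp add: p_def)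
    have Q: "Q \<ge> 0" by (simp add: Q_def sum_nonneg)
    have p_eq: "p = (\<Sum>i<n. (x i - z i) * (y i - z i))"
      by (simp add: p_def vinner_def \<xi>_def sum_subtractf[symmetric] left_diff_distrib)
    \<comment> \<open>The squared distance changes by \<open>u\<^sup>2 Q - 2 u p\<close> along the step, so any small enough \<open>u\<close> will do.\<close>
    define u where "u = min 1 (p / (Q + 1))"
    have u: "0 < u" "u \<le> 1" using p Q by (auto simp: u_def)
    have uQ: "u * Q < 2 * p"
    proof -
      have "u * Q \<le> p / (Q + 1) * Q" using Q by (intro mult_right_mono) (auto simp: u_def)
      also have "\<dots> \<le> p" using p Q by (simp add: field_simps)
      finally show ?thesis using p by simp
    qed
    let ?w = "vadd n (vscale n u x) (vscale n (1 - u) z)"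
    have "?w \<in> K" using body x z u unfolding convex_body_def vconvex_def by simp
    then have "D z \<le> D ?w" by (rule z)
    also have "D ?w = (\<Sum>i<n. ((z i - y i) + u * (x i - z i))\<^sup>2)"
      unfolding D_def by (intro sum.cong) (auto simp: vadd_def vscale_def algebra_simps)
    also have "\<dots> = (\<Sum>i<n. (z i - y i)\<^sup>2 - 2 * u * ((x i - z i) * (y i - z i)) + u\<^sup>2 * (x i - z i)\<^sup>2)"
      by (intro sum.cong) (auto simp: power2_eq_square algebra_simps)
    also have "\<dots> = D z - 2 * u * p + u\<^sup>2 * Q"
      by (simp add: D_def p_eq Q_def sum.distrib sum_subtractf sum_distrib_left)
    finally have "u * (2 * p) \<le> u * (u * Q)" by (simp add: power2_eq_square)
    then show False using u uQ by simp
  qed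
  moreover have "vinner n z \<xi> < vinner n y \<xi>"
  proof -
    have "z \<in> Rn n" using z convex_body_subset[OF body] by blast
    have "\<exists>i<n. y i \<noteq> z i"
    proof (rule ccontr)
      assume "\<not> (\<exists>i<n. y i \<noteq> z i)"
      then have "y = z" using y(1) \<open>z \<in> Rn n\<close> unfolding Rn_def by (intro PiE_ext) auto
      then show False using y z by simp
    qed
    then obtain i where i: "i < n" "y i \<noteq> z i" by blast
    have "0 < (\<Sum>i<n. (y i - z i)\<^sup>2)"
      by (rule sum_pos2[of _ i]) (use i in auto)
    also have "\<dots> = vinner n y \<xi> - vinner n z \<xi>"
      by (simp add: vinner_def \<xi>_def sum_subtractf[symmetric] power2_eq_square left_diff_distrib)
    finally show ?thesis by simp
  qed
  ultimately show ?thesis by blast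
qed

lemma vinner_bounded_convex_body:
  assumes "convex_body n C"
  shows "\<exists>B\<ge>0. \<forall>x\<in>C. \<bar>vinner n x v\<bar> \<le> B"
proof -
  obtain R where R: "R > 0" "\<And>x i. x \<in> C \<Longrightarrow> i < n \<Longrightarrow> \<bar>x i\<bar> \<le> R"
    using convex_body_bounded[OF assms] by blast
  have "\<bar>vinner n x v\<bar> \<le> (\<Sum>i<n. R * \<bar>v i\<bar>)" if "x \<in> C" for x
    unfolding vinner_def using R that
    by (intro order.trans[OF sum_abs] sum_mono) (auto simp: abs_mult intro!: mult_right_mono)
  moreover have "0 \<le> (\<Sum>i<n. R * \<bar>v i\<bar>)" using R by (intro sum_nonneg) auto
  ultimately show ?thesis by blast
qed

lemma set_integrable_vinner:
  assumes "convex_body n C"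
  shows "set_integrable (Rn_lborel n) C (\<lambda>x. vinner n x v)"
proof -
  obtain B where "B \<ge> 0" "\<forall>x\<in>C. \<bar>vinner n x v\<bar> \<le> B" using vinner_bounded_convex_body[OF assms] by blast
  then show ?thesis by (intro set_integrable_convex_body[OF assms]) auto
qed

lemma set_integrable_vinner_mult:
  assumes "convex_body n C"
  shows "set_integrable (Rn_lborel n) C (\<lambda>x. vinner n x v * vinner n x w)"
proof -
  obtain B where B: "B \<ge> 0" "\<forall>x\<in>C. \<bar>vinner n x v\<bar> \<le> B" using vinner_bounded_convex_body[OF assms] by blast
  obtain D where D: "D \<ge> 0" "\<forall>x\<in>C. \<bar>vinner n x w\<bar> \<le> D" using vinner_bounded_convex_body[OF assms] by blast
  show ?thesis
    by (rule set_integrable_convex_body[OF assms, where B = "B * D"]) (use B D in \<open>auto simp: abs_mult intro!: mult_mono\<close>)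
qed

lemma set_integral_sum:
  fixes f :: "'i \<Rightarrow> 'a \<Rightarrow> real"
  assumes "\<And>i. i \<in> I \<Longrightarrow> set_integrable M A (f i)"
  shows "set_integrable M A (\<lambda>x. \<Sum>i\<in>I. f i x)"
    and "(LINT x:A|M. (\<Sum>i\<in>I. f i x)) = (\<Sum>i\<in>I. LINT x:A|M. f i x)"
  using assms unfolding set_integrable_def set_lebesgue_integral_def
  by (simp_all add: sum_distrib_left)

text \<open>
  On \<open>C\<^sup>s\<close> the integrand is a product of functions of the single points.  If \<open>j \<noteq> k\<close>, the factor that
  belongs to \<open>j\<close> has integral zero.
\<close>

lemma product_set_integral_vinner:
  fixes s :: nat
  assumes C: "convex_body n C" and centred: "(LINT x:C|Rn_lborel n. vinner n x v) = 0"
    and m: "(LINT x:C|Rn_lborel n. (vinner n x v)\<^sup>2) = m * vol n C" and jk: "j < s" "k < s"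
  defines P: "P \<equiv> Pi\<^sub>M {..<s} (\<lambda>_. Rn_lborel n)"
  shows "set_integrable P ({..<s} \<rightarrow>\<^sub>E C) (\<lambda>x. vinner n (x j) v * vinner n (x k) v)"
    and "(LINT x:({..<s} \<rightarrow>\<^sub>E C)|P. vinner n (x j) v * vinner n (x k) v) = (if j = k then m * vol n C ^ s else 0)"
proof -
  interpret product_sigma_finite "\<lambda>_::nat. Rn_lborel n"
    by standard (rule sigma_finite_Rn_lborel[THEN sigma_finite_measure.sigma_finite_countable])
  define f where "f l z = indicator C z * ((if l = j then vinner n z v else 1) * (if l = k then vinner n z v else 1))"
    for l :: nat and z
  have CM: "C \<in> sets (Rn_lborel n)" by (rule convex_body_sets[OF C])
  have finC: "emeasure (Rn_lborel n) C < \<infinity>" by (rule convex_body_emeasure_finite[OF C])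
  have CR: "C \<inter> Rn n = C" using convex_body_subset[OF C] by blast
  have one: "integrable (Rn_lborel n) (\<lambda>z. indicat_real C z)" using CM finC by simp
  have f_int: "integrable (Rn_lborel n) (f l)" for l
    using set_integrable_vinner[OF C, of v] set_integrable_vinner_mult[OF C, of v v] one
    unfolding f_def set_integrable_def by (cases "l = j"; cases "l = k") simp_all
  have eq: "indicator ({..<s} \<rightarrow>\<^sub>E C) x *\<^sub>R (vinner n (x j) v * vinner n (x k) v) = (\<Prod>l<s. f l (x l))"
    if "x \<in> space P" for x
  proof -
    have "x \<in> extensional {..<s}" using that by (auto simp: P space_PiM PiE_def)
    then have "indicator ({..<s} \<rightarrow>\<^sub>E C) x = (\<Prod>l<s. indicat_real C (x l))"
      by (auto simp: indicator_def PiE_iff prod_zero_iff)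
    then show ?thesis
      using jk by (simp add: f_def prod.distrib prod.delta)
  qed
  have "integrable P (\<lambda>x. \<Prod>l<s. f l (x l))"
    unfolding P by (rule product_integrable_prod) (use f_int in auto)
  then show "set_integrable P ({..<s} \<rightarrow>\<^sub>E C) (\<lambda>x. vinner n (x j) v * vinner n (x k) v)"
    unfolding set_integrable_def by (subst Bochner_Integration.integrable_cong[OF refl eq]) auto
  have "(LINT x:({..<s} \<rightarrow>\<^sub>E C)|P. vinner n (x j) v * vinner n (x k) v) = (LINT x|P. (\<Prod>l<s. f l (x l)))"
    unfolding set_lebesgue_integral_def by (rule Bochner_Integration.integral_cong[OF refl eq])
  also have "\<dots> = (\<Prod>l<s. LINT z|Rn_lborel n. f l z)"
    unfolding P by (rule product_integral_prod) (use f_int in auto)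
  also have "\<dots> = (if j = k then m * vol n C ^ s else 0)"
  proof (cases "j = k")
    case True
    have "(LINT z|Rn_lborel n. f l z) = vol n C * (if l = j then m else 1)" for l
      using True m CR unfolding f_def set_lebesgue_integral_def
      by (auto simp: power2_eq_square vol_def mult.commute)
    then show ?thesis using True jk by (simp add: prod.distrib prod.delta)
  next
    case False
    have "(LINT z|Rn_lborel n. f j z) = 0"
      using False centred unfolding f_def set_lebesgue_integral_def by simp
    then show ?thesis using False jk by (auto simp: prod_zero_iff)
  qed
  finally show "(LINT x:({..<s} \<rightarrow>\<^sub>E C)|P. vinner n (x j) v * vinner n (x k) v)
    = (if j = k then m * vol n C ^ s else 0)" .
qed

lemma product_second_moment:
  fixes s :: nat
  assumes C: "convex_body n C" and centred: "(LINT x:C|Rn_lborel n. vinner n x v) = 0"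
    and m: "(LINT x:C|Rn_lborel n. (vinner n x v)\<^sup>2) = m * vol n C"
  defines P: "P \<equiv> Pi\<^sub>M {..<s} (\<lambda>_. Rn_lborel n)"
  shows "set_integrable P ({..<s} \<rightarrow>\<^sub>E C) (\<lambda>x. (vinner n (vlincomb n s t x) v)\<^sup>2)"
    and "(LINT x:({..<s} \<rightarrow>\<^sub>E C)|P. (vinner n (vlincomb n s t x) v)\<^sup>2) = m * vol n C ^ s * (\<Sum>j<s. (t j)\<^sup>2)"
proof -
  have sq: "(vinner n (vlincomb n s t x) v)\<^sup>2 = (\<Sum>j<s. \<Sum>k<s. t j * t k * (vinner n (x j) v * vinner n (x k) v))" for x
    by (simp add: vinner_vlincomb power2_eq_square sum_product mult_ac)
  note int = product_set_integral_vinner[OF C centred m, where s = s, folded P]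
  have i1: "set_integrable P ({..<s} \<rightarrow>\<^sub>E C) (\<lambda>x. t j * t k * (vinner n (x j) v * vinner n (x k) v))"
    if "j < s" "k < s" for j k
    using int(1)[OF that] by (rule set_integrable_mult_right)
  show "set_integrable P ({..<s} \<rightarrow>\<^sub>E C) (\<lambda>x. (vinner n (vlincomb n s t x) v)\<^sup>2)"
    unfolding sq by (intro set_integral_sum(1)) (use i1 in auto)
  have "(LINT x:({..<s} \<rightarrow>\<^sub>E C)|P. (vinner n (vlincomb n s t x) v)\<^sup>2)
     = (\<Sum>j<s. \<Sum>k<s. t j * t k * (if j = k then m * vol n C ^ s else 0))"
  proof -
    have "(LINT x:({..<s} \<rightarrow>\<^sub>E C)|P. (\<Sum>j<s. \<Sum>k<s. t j * t k * (vinner n (x j) v * vinner n (x k) v)))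
      = (\<Sum>j<s. LINT x:({..<s} \<rightarrow>\<^sub>E C)|P. (\<Sum>k<s. t j * t k * (vinner n (x j) v * vinner n (x k) v)))"
      by (intro set_integral_sum(2) set_integral_sum(1)) (use i1 in auto)
    also have "\<dots> = (\<Sum>j<s. \<Sum>k<s. LINT x:({..<s} \<rightarrow>\<^sub>E C)|P. t j * t k * (vinner n (x j) v * vinner n (x k) v))"
      by (intro sum.cong refl set_integral_sum(2)) (use i1 in auto)
    also have "\<dots> = (\<Sum>j<s. \<Sum>k<s. t j * t k * (if j = k then m * vol n C ^ s else 0))"
      by (intro sum.cong refl) (simp add: int)
    finally show ?thesis unfolding sq .
  qed
  also have "\<dots> = m * vol n C ^ s * (\<Sum>j<s. (t j)\<^sup>2)"
    by (simp add: sum_distrib_left power2_eq_square mult_ac if_distrib cong: if_cong)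
  finally show "(LINT x:({..<s} \<rightarrow>\<^sub>E C)|P. (vinner n (vlincomb n s t x) v)\<^sup>2) = m * vol n C ^ s * (\<Sum>j<s. (t j)\<^sup>2)" .
qed

section \<open>From functionals to the multi-integral norm\<close>

lemma vinner_cong: "(\<And>i. i < n \<Longrightarrow> \<xi> i = \<eta> i) \<Longrightarrow> vinner n x \<xi> = vinner n x \<eta>"
  by (simp add: vinner_def)

lemma le_sqrt_of_forall_am_gm:
  fixes X W :: real
  assumes "0 \<le> W" "\<And>b. b > 0 \<Longrightarrow> X \<le> (W / b + b) / 2"
  shows "X \<le> sqrt W"
proof (cases "W = 0")
  case True
  show ?thesis
  proof (rule field_le_epsilon)
    fix e :: real assume "e > 0"
    then show "X \<le> sqrt W + e" using assms(2)[of e] True by simp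
  qed
next
  case False
  then have "sqrt W > 0" "W / sqrt W = sqrt W" using assms(1) by (auto simp: real_div_sqrt)
  then show ?thesis using assms(2)[of "sqrt W"] by simp
qed

context symmetric_body
begin

text \<open>
  Duality: if the support function of \<open>K\<close> is at least \<open>A |a|\<close> at the functional with coefficients \<open>a\<close>
  in the basis \<open>v\<close>, then a point outside \<open>q K\<close> is separated from it by some such functional, and the
  Cauchy-Schwarz inequality bounds \<open>A q\<close> by the Euclidean norm of the coordinates \<open>\<langle>y, v k\<rangle>\<close>.
  The support function enters only through its upper bounds \<open>h\<close>.
\<close>

lemma body_norm_le_functionals:
  assumes A: "0 < A"
    and span: "\<And>\<xi>. \<exists>a. \<forall>i<n. \<xi> i = (\<Sum>k<n. a k * v k i)"
    and supp: "\<And>a h. 0 < h \<Longrightarrow> (\<forall>x\<in>K. vinner n x (\<lambda>i. \<Sum>k<n. a k * v k i) \<le> h) \<Longrightarrow> A\<^sup>2 * (\<Sum>k<n. (a k)\<^sup>2) \<le> h\<^sup>2"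
    and y: "y \<in> Rn n"
  shows "body_norm n K y \<le> sqrt (\<Sum>k<n. (vinner n y (v k))\<^sup>2) / A"
proof (rule dense_ge)
  let ?N = "sqrt (\<Sum>k<n. (vinner n y (v k))\<^sup>2)"
  fix q assume q: "?N / A < q"
  have N0: "0 \<le> ?N" by (simp add: sum_nonneg)
  then have q0: "0 < q" using q A by (meson divide_nonneg_pos order_le_less_trans)
  have "y \<in> vscale n q ` K"
  proof (rule ccontr)
    assume "y \<notin> vscale n q ` K"
    then have "vscale n (1 / q) y \<notin> K" using in_vscale_image_iff[OF q0 K_subset y] by simp
    then obtain \<xi> b where sep: "\<forall>x\<in>K. vinner n x \<xi> \<le> b" "b < vinner n (vscale n (1 / q) y) \<xi>"
      using convex_body_separation[OF body vscale_in_Rn] by metis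
    obtain x where x: "x \<in> K"
      using body interior_of_subset[of "Rn_top n" K] unfolding convex_body_def by blast
    have b0: "0 \<le> b" using sep(1) shrink_in[OF x, of 0] by fastforce
    obtain h where h: "b < h" "h < vinner n (vscale n (1 / q) y) \<xi>" using dense[OF sep(2)] by blast
    have h0: "0 < h" using h b0 by simp
    obtain a where a: "\<forall>i<n. \<xi> i = (\<Sum>k<n. a k * v k i)" using span by blast
    have eq: "vinner n x \<xi> = vinner n x (\<lambda>i. \<Sum>k<n. a k * v k i)" for x
      by (rule vinner_cong) (use a in auto)
    have "A\<^sup>2 * (\<Sum>k<n. (a k)\<^sup>2) \<le> h\<^sup>2"
      by (rule supp[OF h0]) (use sep(1) h(1) eq in fastforce)
    then have "(A * L2_set a {..<n})\<^sup>2 \<le> h\<^sup>2"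
      by (simp add: L2_set_def power_mult_distrib sum_nonneg)
    then have Ah: "A * L2_set a {..<n} \<le> h" by (rule power2_le_imp_le) (use h0 in simp)
    have "vinner n y \<xi> = (\<Sum>k<n. a k * vinner n y (v k))" by (simp add: eq vinner_sum_right)
    also have "\<dots> \<le> (\<Sum>k<n. \<bar>a k\<bar> * \<bar>vinner n y (v k)\<bar>)"
      by (intro sum_mono) (metis abs_ge_self abs_mult)
    also have "\<dots> \<le> L2_set a {..<n} * L2_set (\<lambda>k. vinner n y (v k)) {..<n}" by (rule L2_set_mult_ineq)
    also have "\<dots> = L2_set a {..<n} * ?N" by (simp add: L2_set_def)
    finally have "A * vinner n y \<xi> \<le> (A * L2_set a {..<n}) * ?N"
      using A by (simp add: mult.assoc)
    also have "\<dots> \<le> h * ?N" using Ah N0 by (rule mult_right_mono)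
    also have "\<dots> \<le> h * (A * q)" using q A h0 by (intro mult_left_mono) (auto simp: field_simps)
    finally have "vinner n y \<xi> \<le> h * q" using A by (simp add: mult.left_commute)
    then show False using h(2) q0 by (simp add: field_simps)
  qed
  then show "body_norm n K y \<le> q" using q0 by (intro body_norm_le) auto
qed

text \<open>
  The mean of the Euclidean norm of the coordinates is estimated by the root of its second moment.
  In place of the Cauchy-Schwarz inequality for integrals, \<open>\<surd>q \<le> (q / b + b) / 2\<close> is integrated and \<open>b\<close>
  is optimized at the end, so that only the quadratic expression \<open>q\<close> has to be integrated.
\<close>

lemma multi_norm_le_functionals:
  assumes A: "0 < A"
    and span: "\<And>\<xi>. \<exists>a. \<forall>i<n. \<xi> i = (\<Sum>k<n. a k * v k i)"
    and supp: "\<And>a h. 0 < h \<Longrightarrow> (\<forall>x\<in>K. vinner n x (\<lambda>i. \<Sum>k<n. a k * v k i) \<le> h) \<Longrightarrow> A\<^sup>2 * (\<Sum>k<n. (a k)\<^sup>2) \<le> h\<^sup>2"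
    and C: "convex_body n C" and vol: "0 < vol n C"
    and centred: "\<And>k. k < n \<Longrightarrow> (LINT x:C|Rn_lborel n. vinner n x (v k)) = 0"
    and mom: "\<And>k. k < n \<Longrightarrow> (LINT x:C|Rn_lborel n. (vinner n x (v k))\<^sup>2) \<le> m * vol n C" and m: "0 \<le> m"
  shows "multi_norm n s C K t \<le> sqrt (real n * m) / A * L2_set t {..<s}"
proof -
  define P where "P = Pi\<^sub>M {..<s} (\<lambda>_. Rn_lborel n)"
  define S where "S = ({..<s} \<rightarrow>\<^sub>E C)"
  interpret product_sigma_finite "\<lambda>_::nat. Rn_lborel n"
    by standard (rule sigma_finite_Rn_lborel[THEN sigma_finite_measure.sigma_finite_countable])
  define T where "T = (\<Sum>j<s. (t j)\<^sup>2)"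
  define q where "q x = (\<Sum>k<n. (vinner n (vlincomb n s t x) (v k))\<^sup>2)" for x
  define W where "W = real n * m * T"
  have T0: "0 \<le> T" by (simp add: T_def sum_nonneg)
  have W0: "0 \<le> W" using m T0 by (simp add: W_def)
  have CM: "C \<in> sets (Rn_lborel n)" by (rule convex_body_sets[OF C])
  have finC: "emeasure (Rn_lborel n) C = ennreal (vol n C)"
    using convex_body_emeasure_finite[OF C] by (simp add: emeasure_eq_ennreal_measure vol_def)
  have S: "S \<in> sets P" unfolding S_def P_def using CM by (intro sets_PiM_I_finite) auto
  have emS: "emeasure P S = ennreal (vol n C ^ s)"
    unfolding S_def P_def using CM vol by (subst emeasure_PiM) (auto simp: finC ennreal_power)
  have one: "set_integrable P S (\<lambda>_. c::real)" for c
    using S emS unfolding set_integrable_def by simp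
  have int_one: "(LINT x:S|P. (c::real)) = c * vol n C ^ s" for c
  proof -
    have "(LINT x:S|P. c) = c * measure P (S \<inter> space P)" by (simp add: set_lebesgue_integral_def mult.commute)
    also have "S \<inter> space P = S" using sets.sets_into_space[OF S] by blast
    finally show ?thesis using emS vol by (simp add: measure_def)
  qed
  define \<mu> where "\<mu> k = (LINT x:C|Rn_lborel n. (vinner n x (v k))\<^sup>2) / vol n C" for k
  have \<mu>: "(LINT x:C|Rn_lborel n. (vinner n x (v k))\<^sup>2) = \<mu> k * vol n C" for k
    using vol by (simp add: \<mu>_def)
  have \<mu>m: "\<mu> k \<le> m" if "k < n" for k using mom[OF that] vol by (simp add: \<mu>)
  note moments = product_second_moment[OF C centred \<mu>, where s = s and t = t, folded P_def S_def]
  have q_int: "set_integrable P S q"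
    unfolding q_def by (intro set_integral_sum(1)) (use moments(1) in auto)
  have "(LINT x:S|P. q x) = (\<Sum>k<n. \<mu> k * vol n C ^ s * T)"
    unfolding q_def by (subst set_integral_sum(2)) (use moments in \<open>auto simp: T_def\<close>)
  also have "\<dots> \<le> (\<Sum>k<n. m * vol n C ^ s * T)"
    by (intro sum_mono mult_right_mono) (use \<mu>m T0 vol in auto)
  finally have q_le: "(LINT x:S|P. q x) \<le> W * vol n C ^ s" by (simp add: W_def mult_ac)
  have "A * multi_norm n s C K t \<le> (W / b + b) / 2" if b: "b > 0" for b
  proof -
    define g where "g x = (q x / b + b) / (2 * A)" for x
    have g_eq: "g x = (1 / (2 * A * b)) * q x + b / (2 * A)" for x
      using A b by (simp add: g_def field_simps)
    have g_int: "set_integrable P S g"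
      unfolding g_eq by (intro set_integral_add(1) set_integrable_mult_right q_int one)
    have norm_le: "body_norm n K (vlincomb n s t x) \<le> g x" for x
    proof -
      have q0: "0 \<le> q x" by (simp add: q_def sum_nonneg)
      have "body_norm n K (vlincomb n s t x) \<le> sqrt (q x) / A"
        unfolding q_def by (rule body_norm_le_functionals[OF A span supp]) auto
      also have "sqrt (q x) \<le> (q x / b + b) / 2"
      proof -
        have "0 \<le> (sqrt (q x) - b)\<^sup>2" by simp
        then have "2 * sqrt (q x) * b \<le> q x + b\<^sup>2" using q0 by (simp add: power2_eq_square algebra_simps)
        then show ?thesis using b by (simp add: field_simps power2_eq_square)
      qed
      finally show ?thesis using A by (simp add: g_def field_simps divide_right_mono)
    qed
    have "(LINT x:S|P. body_norm n K (vlincomb n s t x)) \<le> (LINT x:S|P. g x)"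
      unfolding set_lebesgue_integral_def
    \<comment> \<open>If the norm were not integrable, its integral would be \<open>0\<close>, so the integrability of the larger function suffices.\<close>
    proof (rule integral_mono')
      show "integrable P (\<lambda>x. indicat_real S x *\<^sub>R g x)" using g_int by (simp add: set_integrable_def)
      fix x
      show "indicat_real S x *\<^sub>R body_norm n K (vlincomb n s t x) \<le> indicat_real S x *\<^sub>R g x"
        using norm_le[of x] by (simp add: mult_left_mono)
      have "0 \<le> g x" using norm_le[of x] body_norm_nonneg[of "vlincomb n s t x"] by simp
      then show "0 \<le> indicat_real S x *\<^sub>R g x" by simp
    qed
    also have "\<dots> = (1 / (2 * A * b)) * (LINT x:S|P. q x) + b / (2 * A) * vol n C ^ s"
      unfolding g_eq by (subst set_integral_add(2)) (auto intro: q_int one set_integrable_mult_right simp: int_one)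
    also have "\<dots> \<le> (1 / (2 * A * b)) * (W * vol n C ^ s) + b / (2 * A) * vol n C ^ s"
      using A b q_le by (intro add_right_mono mult_left_mono) auto
    also have "\<dots> = vol n C ^ s * ((W / b + b) / (2 * A))"
      using A b by (simp add: field_simps)
    finally have "multi_norm n s C K t \<le> (W / b + b) / (2 * A)"
      using vol unfolding multi_norm_def P_def S_def by (simp add: field_simps)
    then show ?thesis using A by (simp add: field_simps)
  qed
  then have "A * multi_norm n s C K t \<le> sqrt W" by (rule le_sqrt_of_forall_am_gm[OF W0])
  also have "sqrt W = sqrt (real n * m) * L2_set t {..<s}"
    by (simp add: W_def T_def L2_set_def real_sqrt_mult)
  finally show ?thesis using A by (simp add: field_simps)
qed

lemma set_integral_vinner_eq_0: "(LINT x:K|Rn_lborel n. vinner n x v) = 0"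
proof -
  let ?M = "Rn_lborel n"
  let ?f = "\<lambda>x. indicat_real K x *\<^sub>R vinner n x v"
  have "(LINT x|?M. ?f x) = (LINT x|distr ?M ?M (vscale n (-1)). ?f x)"
    unfolding distr_Rn_lborel_uminus ..
  also have "\<dots> = (LINT x|?M. ?f (vscale n (-1) x))"
    by (rule integral_distr) measurable
  also have "\<dots> = (LINT x|?M. - ?f x)"
  proof (rule Bochner_Integration.integral_cong[OF refl])
    fix x assume "x \<in> space ?M"
    then have "vscale n (-1) x \<in> K \<longleftrightarrow> x \<in> K"
      using uminus_in[of "vscale n (-1) x"] uminus_in[of x] by (auto simp: vscale_vscale vscale_1)
    then show "?f (vscale n (-1) x) = - ?f x" by (auto simp: indicator_def)
  qed
  finally show ?thesis by (simp add: set_lebesgue_integral_def)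
qed

text \<open>
  \<open>K\<close> contains a cube about the origin, hence a multiple of \<open>\<xi>\<close> whose length does not depend on \<open>\<xi>\<close>.
\<close>

lemma L2_set_le_support:
  shows "\<exists>r>0. \<forall>\<xi> h. (\<forall>x\<in>K. vinner n x \<xi> \<le> h) \<longrightarrow> r * L2_set \<xi> {..<n} \<le> h"
proof -
  obtain e where e: "e > 0" "\<forall>x\<in>Rn n. (\<forall>i<n. \<bar>x i\<bar> < e) \<longrightarrow> x \<in> K"
    using symmetric_convex_body_box[OF body sym] by blast
  show ?thesis
  proof (intro exI[of _ "e / 2"] conjI allI impI)
    fix \<xi> h assume h: "\<forall>x\<in>K. vinner n x \<xi> \<le> h"
    let ?l = "L2_set \<xi> {..<n}"
    let ?x = "vscale n (e / (2 * ?l)) \<xi>"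
    have "?x \<in> K"
    proof (rule e(2)[rule_format])
      fix i assume "i < n"
      then have "\<bar>\<xi> i\<bar> \<le> ?l" using member_le_L2_set[of "{..<n}" i "\<lambda>i. \<bar>\<xi> i\<bar>"] by (simp add: L2_set_def)
      then show "\<bar>?x i\<bar> < e"
        using e(1) \<open>i < n\<close> by (cases "?l = 0") (auto simp: vscale_def abs_mult field_simps intro: order_le_less_trans)
    qed simp
    then have "vinner n ?x \<xi> \<le> h" using h by blast
    also have "vinner n ?x \<xi> = e / (2 * ?l) * ?l\<^sup>2"
      by (simp add: L2_set_def sum_nonneg) (simp add: vinner_def power2_eq_square)
    also have "\<dots> = e / 2 * ?l" by (cases "?l = 0") (auto simp: power2_eq_square)
    finally show "e / 2 * ?l \<le> h" .
  qed (use e in auto)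
qed

text \<open>
  Take \<open>x\<close> where a functional exceeds half its supremum; then \<open>x\<close> and \<open>-x\<close> are at distance at least \<open>1\<close>,
  and the norm of their midpoint is non-negative.
\<close>

lemma two_convex_constant_le_1:
  assumes tc: "two_convex n K \<alpha>" and n: "n \<ge> 1"
  shows "\<alpha> \<le> 1"
proof -
  define \<xi> where "\<xi> i = (if i = 0 then 1 else 0 :: real)" for i :: nat
  let ?S = "(\<lambda>x. vinner n x \<xi>) ` K"
  define h where "h = Sup ?S"
  obtain B where "\<forall>x\<in>K. \<bar>vinner n x \<xi>\<bar> \<le> B" using vinner_bounded_convex_body[OF body] by blast
  then have bd: "bdd_above ?S" by (intro bdd_aboveI2[of _ _ B]) (auto simp: abs_le_iff)
  have h_ub: "vinner n x \<xi> \<le> h" if "x \<in> K" for x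
    unfolding h_def using bd that by (intro cSup_upper) auto
  obtain r where r: "r > 0" "\<And>\<xi> h. (\<forall>x\<in>K. vinner n x \<xi> \<le> h) \<Longrightarrow> r * L2_set \<xi> {..<n} \<le> h"
    using L2_set_le_support by blast
  have "(\<Sum>i<n. (\<xi> i)\<^sup>2) = (\<Sum>i<n. if i = 0 then 1 else 0)"
    by (rule sum.cong) (auto simp: \<xi>_def)
  then have "L2_set \<xi> {..<n} = 1" using n by (simp add: L2_set_def)
  then have h0: "h > 0" using r(1) r(2)[of \<xi> h] h_ub by simp
  have "K \<noteq> {}" using body interior_of_subset[of "Rn_top n" K] unfolding convex_body_def by blast
  then obtain x where x: "x \<in> K" "h / 2 < vinner n x \<xi>"
    using less_cSup_iff[of ?S "h / 2"] bd h0 by (auto simp: h_def)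
  let ?y = "vscale n (-1) x"
  have y: "?y \<in> K" using x by (intro uminus_in)
  have "1 \<le> vinner n (vsub n x ?y) \<xi> / h" using x h0 by (simp add: field_simps)
  also have "\<dots> \<le> body_norm n K (vsub n x ?y)" by (rule vinner_le_body_norm) (use h0 h_ub in auto)
  finally have "body_norm n K (vscale n (1/2) (vadd n x ?y)) \<le> 1 - \<alpha> * 1\<^sup>2"
    using two_convex_midpoint[OF tc _ _ x(1) y, of 1] by simp
  then show ?thesis using body_norm_nonneg[of "vscale n (1/2) (vadd n x ?y)"] by simp
qed

end

section \<open>Uniform points of a 2-convex body\<close>

lemma linear_functional_sum:
  fixes B :: "(nat \<Rightarrow> real) \<Rightarrow> 'b \<Rightarrow> real" and l :: nat
  assumes lin: "\<And>a u b w z. B (\<lambda>i. a * u i + b * w i) z = a * B u z + b * B w z"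
  shows "B (\<lambda>i. \<Sum>j<l. c j * v j i) z = (\<Sum>j<l. c j * B (v j) z)"
proof (induction l)
  case 0
  show ?case using lin[of 0 "\<lambda>_. 0" 0 "\<lambda>_. 0" z] by simp
next
  case (Suc l)
  show ?case using lin[of 1 "\<lambda>i. \<Sum>j<l. c j * v j i" "c l" "v l" z] Suc by simp
qed

text \<open>
  Orthogonalization of the first \<open>k\<close> unit vectors for a positive definite form.  The vectors already
  constructed vanish from the \<open>k\<close>-th coordinate on, so the new vector \<open>w\<close> has \<open>k\<close>-th coordinate \<open>1\<close>; this
  is why it is non-zero and why subtracting a multiple of it reduces to the span of the previous ones.
\<close>

lemma gram_schmidt:
  fixes B :: "(nat \<Rightarrow> real) \<Rightarrow> (nat \<Rightarrow> real) \<Rightarrow> real"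
  assumes sym: "\<And>u w. B u w = B w u"
    and lin: "\<And>a u b w z. B (\<lambda>i. a * u i + b * w i) z = a * B u z + b * B w z"
    and pos: "\<And>u. \<exists>i<n. u i \<noteq> 0 \<Longrightarrow> 0 < B u u"
  shows "k \<le> n \<Longrightarrow> \<exists>v. (\<forall>i<k. \<forall>j<k. B (v i) (v j) = (if i = j then 1 else 0)) \<and> (\<forall>j<k. \<forall>i\<ge>k. v j i = 0)
      \<and> (\<forall>\<xi>. (\<forall>i\<ge>k. \<xi> i = 0) \<longrightarrow> (\<exists>a. \<forall>i. \<xi> i = (\<Sum>j<k. a j * v j i)))"
proof (induction k)
  case 0
  then show ?case by auto
next
  case (Suc k)
  then obtain v where v_all: "(\<forall>i<k. \<forall>j<k. B (v i) (v j) = (if i = j then 1 else 0)) \<and> (\<forall>j<k. \<forall>i\<ge>k. v j i = 0)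
      \<and> (\<forall>\<xi>. (\<forall>i\<ge>k. \<xi> i = 0) \<longrightarrow> (\<exists>a. \<forall>i. \<xi> i = (\<Sum>j<k. a j * v j i)))"
    using Suc_leD by metis
  have v: "\<And>i j. i < k \<Longrightarrow> j < k \<Longrightarrow> B (v i) (v j) = (if i = j then 1 else 0)"
      "\<And>i j. j < k \<Longrightarrow> k \<le> i \<Longrightarrow> v j i = 0"
      "\<And>\<xi>. \<forall>i\<ge>k. \<xi> i = 0 \<Longrightarrow> \<exists>a. \<forall>i. \<xi> i = (\<Sum>j<k. a j * v j i)"
    using v_all by simp_all
  note sum = linear_functional_sum[of B, OF lin]
  have scale: "B (\<lambda>i. a * u i) z = a * B u z" for a u z using lin[of a u 0 u z] by simp
  define e where "e i = (if i = k then 1 else 0 :: real)" for i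
  define w where "w i = e i - (\<Sum>j<k. B e (v j) * v j i)" for i
  have w_orth: "B w (v l) = 0" if "l < k" for l
  proof -
    have "B w (v l) = B e (v l) - (\<Sum>j<k. B e (v j) * B (v j) (v l))"
      unfolding w_def using lin[of 1 e "-1" "\<lambda>i. \<Sum>j<k. B e (v j) * v j i" "v l"] by (simp add: sum)
    also have "(\<Sum>j<k. B e (v j) * B (v j) (v l)) = (\<Sum>j<k. if j = l then B e (v l) else 0)"
      using that by (intro sum.cong) (auto simp: v)
    finally show ?thesis using that by simp
  qed
  have wk: "w k = 1" by (simp add: w_def e_def v)
  have w0: "w i = 0" if "Suc k \<le> i" for i using that by (simp add: w_def e_def v)
  define q where "q = B w w"
  have q: "q > 0" unfolding q_def by (rule pos) (use Suc.prems wk in \<open>auto intro: exI[of _ k]\<close>)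
  define v' where "v' = v(k := (\<lambda>i. 1 / sqrt q * w i))"
  have v'k: "v' k = (\<lambda>i. 1 / sqrt q * w i)" and v'l: "\<And>l. l < k \<Longrightarrow> v' l = v l"
    by (auto simp: v'_def)
  have orth: "B (v' k) (v' l) = 0" if "l < k" for l
    using that by (simp only: v'k v'l scale w_orth)
  have norm: "B (v' k) (v' k) = 1"
  proof -
    have "B (v' k) (v' k) = 1 / sqrt q * (1 / sqrt q * B w w)"
      unfolding v'k scale by (subst sym) (simp only: scale)
    then show ?thesis using q by (simp add: q_def[symmetric])
  qed
  show ?case
  proof (intro exI[of _ v'] conjI allI impI)
    fix i j assume "i < Suc k" "j < Suc k"
    then show "B (v' i) (v' j) = (if i = j then 1 else 0)"
      using v(1)[of i j] orth[of i] orth[of j] norm sym[of "v' i" "v' j"] v'l[of i] v'l[of j]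
      by (auto simp: less_Suc_eq)
  next
    fix j i assume "j < Suc k" "Suc k \<le> i"
    then show "v' j i = 0" using v(2)[of j i] w0[of i] by (auto simp: less_Suc_eq v'k v'l)
  next
    fix \<xi> :: "nat \<Rightarrow> real" assume \<xi>: "\<forall>i\<ge>Suc k. \<xi> i = 0"
    have "\<forall>i\<ge>k. \<xi> i - \<xi> k * w i = 0"
      using \<xi> wk w0 by (metis diff_self le_antisym mult.right_neutral mult_zero_right not_less_eq_eq)
    from v(3)[OF this] obtain a where a: "\<And>i. \<xi> i - \<xi> k * w i = (\<Sum>j<k. a j * v j i)" by blast
    have "\<xi> i = (\<Sum>j<Suc k. (a(k := \<xi> k * sqrt q)) j * v' j i)" for i
    proof -
      have "(\<Sum>j<k. (a(k := \<xi> k * sqrt q)) j * v' j i) = (\<Sum>j<k. a j * v j i)"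
        by (intro sum.cong) (auto simp: v'l)
      then show ?thesis using a[of i] q by (simp add: v'k)
    qed
    then show "\<exists>a. \<forall>i. \<xi> i = (\<Sum>j<Suc k. a j * v' j i)" by blast
  qed
qed

lemma gram_schmidt_basis:
  fixes B :: "(nat \<Rightarrow> real) \<Rightarrow> (nat \<Rightarrow> real) \<Rightarrow> real"
  assumes sym: "\<And>u w. B u w = B w u"
    and lin: "\<And>a u b w z. B (\<lambda>i. a * u i + b * w i) z = a * B u z + b * B w z"
    and pos: "\<And>u. \<exists>i<n. u i \<noteq> 0 \<Longrightarrow> 0 < B u u"
  shows "\<exists>v. (\<forall>k<n. B (v k) (v k) = 1)
    \<and> (\<forall>\<xi>. \<exists>a. \<forall>i<n. \<xi> i = (\<Sum>k<n. a k * v k i))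
    \<and> (\<forall>a. B (\<lambda>i. \<Sum>k<n. a k * v k i) (\<lambda>i. \<Sum>k<n. a k * v k i) = (\<Sum>k<n. (a k)\<^sup>2))"
proof -
  obtain v where v_all: "(\<forall>i<n. \<forall>j<n. B (v i) (v j) = (if i = j then 1 else 0)) \<and> (\<forall>j<n. \<forall>i\<ge>n. v j i = 0)
      \<and> (\<forall>\<xi>. (\<forall>i\<ge>n. \<xi> i = 0) \<longrightarrow> (\<exists>a. \<forall>i. \<xi> i = (\<Sum>j<n. a j * v j i)))"
    using gram_schmidt[OF sym lin pos order.refl] ..
  have v: "\<And>i j. i < n \<Longrightarrow> j < n \<Longrightarrow> B (v i) (v j) = (if i = j then 1 else 0)"
      "\<And>\<xi>. \<forall>i\<ge>n. \<xi> i = 0 \<Longrightarrow> \<exists>a. \<forall>i. \<xi> i = (\<Sum>j<n. a j * v j i)"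
    using v_all by simp_all
  note sum = linear_functional_sum[of B, OF lin]
  show ?thesis
  proof (intro exI[of _ v] conjI allI impI)
    show "B (v k) (v k) = 1" if "k < n" for k using that v(1) by simp
    show "\<exists>a. \<forall>i<n. \<xi> i = (\<Sum>k<n. a k * v k i)" for \<xi>
    proof -
      obtain a where a: "\<forall>i. (if i < n then \<xi> i else 0) = (\<Sum>j<n. a j * v j i)"
        using v(2)[of "\<lambda>i. if i < n then \<xi> i else 0"] by auto
      have "\<forall>i<n. \<xi> i = (\<Sum>k<n. a k * v k i)"
        using a by metis
      then show ?thesis by (intro exI[of _ a])
    qed
    fix a :: "nat \<Rightarrow> real"
    have "B (\<lambda>i. \<Sum>k<n. a k * v k i) (\<lambda>i. \<Sum>k<n. a k * v k i) = (\<Sum>j<n. a j * (\<Sum>k<n. a k * B (v k) (v j)))"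
      by (subst sum, subst sym, subst sum) simp
    also have "\<dots> = (\<Sum>j<n. a j * (\<Sum>k<n. if k = j then a k else 0))"
      by (intro sum.cong refl arg_cong2[where f = times]) (auto simp: v)
    also have "\<dots> = (\<Sum>k<n. (a k)\<^sup>2)" by (simp add: power2_eq_square)
    finally show "B (\<lambda>i. \<Sum>k<n. a k * v k i) (\<lambda>i. \<Sum>k<n. a k * v k i) = (\<Sum>k<n. (a k)\<^sup>2)" .
  qed
qed

lemma vinner_lin: "vinner n x (\<lambda>i. a * u i + b * w i) = a * vinner n x u + b * vinner n x w"
  by (simp add: vinner_def algebra_simps sum.distrib sum_distrib_left)

text \<open>
  The functionals are orthonormal for the covariance form \<open>m\<close> of \<open>K\<close>, perturbed by a small multiple of
  the standard inner product.  The perturbation makes positive definiteness evident, and \<open>\<epsilon>\<close> is chosen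
  so that a cube contained in \<open>K\<close> pays for it: it costs a factor of two in \<open>A\<^sup>2\<close>.
\<close>

lemma (in symmetric_body) multi_norm_self_le:
  assumes tc: "two_convex n K \<alpha>" and \<alpha>: "0 < \<alpha>" and n: "n \<ge> 1" and s: "s \<ge> 1"
  shows "multi_norm n s K K t \<le> 2 / sqrt \<alpha> * L2_set t {..<s}"
proof (cases "vol n K = 0")
  case True
  \<comment> \<open>If the volume were \<open>0\<close>, the normalizing factor \<open>1 / 0\<close> and with it the norm would be \<open>0\<close>.\<close>
  then show ?thesis using s \<alpha> by (simp add: multi_norm_def power_0_left)
next
  case False
  then have vol: "0 < vol n K" by (simp add: vol_def zero_less_measure_iff)
  have np: "0 < \<alpha> * real n" using n \<alpha> by simp
  obtain r where r: "r > 0" "\<And>\<xi> h. (\<forall>x\<in>K. vinner n x \<xi> \<le> h) \<Longrightarrow> r * L2_set \<xi> {..<n} \<le> h"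
    using L2_set_le_support by blast
  define \<epsilon> where "\<epsilon> = 2 * r\<^sup>2 / (\<alpha> * real n)"
  have \<epsilon>: "\<epsilon> > 0" using r np by (simp add: \<epsilon>_def)
  define m where "m u w = (LINT x:K|Rn_lborel n. vinner n x u * vinner n x w) / vol n K" for u w
  define B where "B u w = m u w + \<epsilon> * vinner n u w" for u w
  have B_sym: "B u w = B w u" for u w by (simp add: B_def m_def vinner_def mult.commute)
  have m_lin: "m (\<lambda>i. a * u i + b * w i) z = a * m u z + b * m w z" for a u b w z
  proof -
    have "(LINT x:K|Rn_lborel n. vinner n x (\<lambda>i. a * u i + b * w i) * vinner n x z)
      = (LINT x:K|Rn_lborel n. a * (vinner n x u * vinner n x z) + b * (vinner n x w * vinner n x z))"
      by (simp add: vinner_lin algebra_simps)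
    also have "\<dots> = a * (LINT x:K|Rn_lborel n. vinner n x u * vinner n x z)
      + b * (LINT x:K|Rn_lborel n. vinner n x w * vinner n x z)"
      by (subst set_integral_add(2)) (auto intro: set_integrable_vinner_mult[OF body])
    finally show ?thesis by (simp add: m_def add_divide_distrib)
  qed
  have B_lin: "B (\<lambda>i. a * u i + b * w i) z = a * B u z + b * B w z" for a u b w z
  proof -
    have "vinner n (\<lambda>i. a * u i + b * w i) z = a * vinner n u z + b * vinner n w z"
      by (simp add: vinner_def algebra_simps sum.distrib sum_distrib_left)
    then show ?thesis by (simp add: B_def m_lin algebra_simps)
  qed
  have m_nonneg: "0 \<le> m u u" for u
    unfolding m_def set_lebesgue_integral_def using vol by (intro divide_nonneg_pos integral_nonneg_AE) auto
  have B_pos: "0 < B u u" if u: "\<exists>i<n. u i \<noteq> 0" for u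
  proof -
    obtain i where i: "i < n" "u i \<noteq> 0" using u by blast
    have "0 < vinner n u u" unfolding vinner_def
      by (rule sum_pos2[of _ i]) (use i in \<open>auto simp: zero_less_mult_iff linorder_neq_iff\<close>)
    then show ?thesis unfolding B_def using m_nonneg[of u] \<epsilon> by (simp add: add_nonneg_pos)
  qed
  obtain v where v_all: "(\<forall>k<n. B (v k) (v k) = 1)
    \<and> (\<forall>\<xi>. \<exists>a. \<forall>i<n. \<xi> i = (\<Sum>k<n. a k * v k i))
    \<and> (\<forall>a. B (\<lambda>i. \<Sum>k<n. a k * v k i) (\<lambda>i. \<Sum>k<n. a k * v k i) = (\<Sum>k<n. (a k)\<^sup>2))"
    using gram_schmidt_basis[of B n, OF B_sym B_lin B_pos] ..
  have v: "\<And>k. k < n \<Longrightarrow> B (v k) (v k) = 1"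
    "\<And>\<xi>. \<exists>a. \<forall>i<n. \<xi> i = (\<Sum>k<n. a k * v k i)"
    "\<And>a. B (\<lambda>i. \<Sum>k<n. a k * v k i) (\<lambda>i. \<Sum>k<n. a k * v k i) = (\<Sum>k<n. (a k)\<^sup>2)"
    using v_all by simp_all
  let ?A = "sqrt (\<alpha> * real n) / 2"
  have "multi_norm n s K K t \<le> sqrt (real n * 1) / ?A * L2_set t {..<s}"
  proof (rule multi_norm_le_functionals[OF _ v(2) _ body vol set_integral_vinner_eq_0])
    show "0 < ?A" using np by simp
    fix a h assume h: "0 < h" "\<forall>x\<in>K. vinner n x (\<lambda>i. \<Sum>k<n. a k * v k i) \<le> h"
    let ?\<xi> = "\<lambda>i. \<Sum>k<n. a k * v k i"
    have "\<alpha> * real n * (m ?\<xi> ?\<xi> * vol n K) \<le> 2 * h\<^sup>2 * vol n K"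
      using two_convex_second_moment[OF tc \<alpha> n h(1), of ?\<xi>] h(2) vol by (simp add: m_def power2_eq_square)
    then have 1: "\<alpha> * real n * m ?\<xi> ?\<xi> \<le> 2 * h\<^sup>2" using vol by simp
    have "(r * L2_set ?\<xi> {..<n})\<^sup>2 \<le> h\<^sup>2"
      by (rule power_mono[OF r(2)[OF h(2)]]) (use r in simp)
    also have "(r * L2_set ?\<xi> {..<n})\<^sup>2 = r\<^sup>2 * vinner n ?\<xi> ?\<xi>"
      by (simp add: power_mult_distrib L2_set_def sum_nonneg) (simp add: vinner_def power2_eq_square)
    finally have 2: "r\<^sup>2 * vinner n ?\<xi> ?\<xi> \<le> h\<^sup>2" .
    have "\<alpha> * real n * B ?\<xi> ?\<xi> = \<alpha> * real n * m ?\<xi> ?\<xi> + 2 * (r\<^sup>2 * vinner n ?\<xi> ?\<xi>)"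
      using np n \<alpha> by (simp add: B_def \<epsilon>_def field_simps)
    also have "\<dots> \<le> 4 * h\<^sup>2" using 1 2 by simp
    finally show "?A\<^sup>2 * (\<Sum>k<n. (a k)\<^sup>2) \<le> h\<^sup>2"
      using np by (simp add: v(3) power_divide)
  next
    fix k assume k: "k < n"
    have "m (v k) (v k) \<le> B (v k) (v k)"
      unfolding B_def using \<epsilon> by (simp add: vinner_def sum_nonneg)
    then have "m (v k) (v k) \<le> 1" using v(1)[OF k] by simp
    then show "(LINT x:K|Rn_lborel n. (vinner n x (v k))\<^sup>2) \<le> 1 * vol n K"
      using vol by (simp add: m_def power2_eq_square divide_le_eq)
  qed simp
  also have "sqrt (real n * 1) / ?A = 2 / sqrt \<alpha>"
    using n \<alpha> by (simp add: real_sqrt_mult)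
  finally show ?thesis .
qed

section \<open>Isotropic bodies\<close>

lemma isotropic_second_moment:
  assumes "has_isotropic_constant n C L"
  shows "(LINT x:C|Rn_lborel n. (vinner n x \<xi>)\<^sup>2) = L\<^sup>2 * (\<Sum>i<n. (\<xi> i)\<^sup>2)"
proof (cases "(\<Sum>i<n. (\<xi> i)\<^sup>2) = 0")
  case True
  then have "\<forall>i<n. \<xi> i = 0" by (simp add: sum_nonneg_eq_0_iff)
  then have "vinner n x \<xi> = 0" for x by (simp add: vinner_def)
  then show ?thesis by (simp add: True set_lebesgue_integral_def)
next
  case False
  define l where "l = L2_set \<xi> {..<n}"
  have l2: "l\<^sup>2 = (\<Sum>i<n. (\<xi> i)\<^sup>2)" by (simp add: l_def L2_set_def sum_nonneg)
  have l: "l \<noteq> 0" using False l2 by auto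
  define \<eta> where "\<eta> = vscale n (1 / l) \<xi>"
  have "(\<Sum>i<n. (\<eta> i)\<^sup>2) = (\<Sum>i<n. (\<xi> i)\<^sup>2 / l\<^sup>2)"
    by (intro sum.cong) (auto simp: \<eta>_def vscale_def power_divide)
  also have "\<dots> = (\<Sum>i<n. (\<xi> i)\<^sup>2) / l\<^sup>2" by (simp add: sum_divide_distrib)
  also have "\<dots> = 1" using False by (simp add: l2)
  finally have "\<eta> \<in> vsphere n" by (simp add: vsphere_def L2_set_def \<eta>_def)
  then have "(LINT x:C|Rn_lborel n. (vinner n x \<eta>)\<^sup>2) = L\<^sup>2"
    using assms by (simp add: has_isotropic_constant_def)
  moreover have "(vinner n x \<xi>)\<^sup>2 = l\<^sup>2 * (vinner n x \<eta>)\<^sup>2" for x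
  proof -
    have "vinner n x \<eta> = vinner n x \<xi> / l"
      by (simp add: vinner_def \<eta>_def vscale_def sum_divide_distrib)
    then show ?thesis using l by (simp add: power_divide)
  qed
  ultimately show ?thesis by (simp add: l2 mult.commute)
qed

definition unit_vec :: "nat \<Rightarrow> nat \<Rightarrow> real" where "unit_vec k i = (if i = k then 1 else 0)"

lemma vinner_unit_vec [simp]: "k < n \<Longrightarrow> vinner n x (unit_vec k) = x k"
  by (simp add: vinner_def unit_vec_def if_distrib cong: if_cong)

lemma sum_unit_vec: "i < n \<Longrightarrow> (\<Sum>k<n. a k * unit_vec k i) = a i"
  by (simp add: unit_vec_def if_distrib cong: if_cong)

lemma coordinate_second_moment:
  assumes "has_isotropic_constant n C L" "k < n"
  shows "(LINT x:C|Rn_lborel n. (x k)\<^sup>2) = L\<^sup>2"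
proof -
  have "(\<Sum>i<n. (unit_vec k i)\<^sup>2) = (\<Sum>i<n. if i = k then 1 else 0)"
    by (rule sum.cong) (auto simp: unit_vec_def)
  then show ?thesis using isotropic_second_moment[OF assms(1), of "unit_vec k"] assms(2) by simp
qed

text \<open>
  A body of volume \<open>1\<close> cannot be too concentrated, because a product density \<open>g\<close> of integral \<open>1\<close> has
  integral at most \<open>1\<close> over it.  For the centred Gaussian of variance \<open>1 / (2 \<pi> e)\<close> one has
  \<open>g x = exp (n / 2 - \<pi> e |x|\<^sup>2) \<ge> 1 + n / 2 - \<pi> e |x|\<^sup>2\<close>, and the right-hand side has integral
  \<open>1 + n / 2 - \<pi> e n L\<^sup>2\<close> over \<open>K\<close>.  The variance is small enough for the constant term of the exponent to be
  positive; like the integral of \<open>|x|\<^sup>2\<close>, it is proportional to \<open>n\<close>, so \<open>n\<close> cancels.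
\<close>

lemma isotropic_constant_lower_bound:
  assumes body: "convex_body n K" and vol: "vol n K = 1" and L: "has_isotropic_constant n K L" and n: "n \<ge> 1"
  shows "1 \<le> 2 * pi * exp 1 * L\<^sup>2"
proof -
  interpret product_sigma_finite "\<lambda>_::nat. lborel :: real measure" by (rule product_sigma_finite_lborel)
  let ?M = "Rn_lborel n"
  define \<sigma> where "\<sigma> = 1 / sqrt (2 * pi * exp 1)"
  have \<sigma>: "\<sigma> > 0" by (simp add: \<sigma>_def)
  have \<sigma>2: "\<sigma>\<^sup>2 = 1 / (2 * pi * exp 1)" by (simp add: \<sigma>_def power_divide)
  have dens: "normal_density 0 \<sigma> x = exp (1/2 - pi * exp 1 * x\<^sup>2)" for x
  proof -
    have "sqrt (exp 1) = exp (1/2 :: real)"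
      by (rule real_sqrt_unique) (simp_all add: power2_eq_square flip: exp_add)
    moreover have "2 * pi * \<sigma>\<^sup>2 = 1 / exp 1" by (simp add: \<sigma>2)
    moreover have "- (x - 0)\<^sup>2 / (2 * \<sigma>\<^sup>2) = - (pi * exp 1 * x\<^sup>2)" by (simp add: \<sigma>2)
    ultimately have "normal_density 0 \<sigma> x = exp (1/2) * exp (- (pi * exp 1 * x\<^sup>2))"
      unfolding normal_density_def by (simp add: real_sqrt_divide)
    then show ?thesis by (simp flip: exp_add)
  qed
  have K: "K \<in> sets ?M" by (rule convex_body_sets[OF body])
  have KR: "K \<inter> Rn n = K" using convex_body_subset[OF body] by blast
  define q where "q x = 1 + real n / 2 - pi * exp 1 * (\<Sum>i<n. (x i)\<^sup>2)" for x :: "nat \<Rightarrow> real"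
  have sq_int: "set_integrable ?M K (\<lambda>x. (x i)\<^sup>2)" if "i < n" for i
    using set_integrable_vinner_mult[OF body, of "unit_vec i" "unit_vec i"] that by (simp add: power2_eq_square)
  have one: "set_integrable ?M K (\<lambda>x. c::real)" for c
    by (rule set_integrable_convex_body[OF body]) auto
  have s_int: "set_integrable ?M K (\<lambda>x. pi * exp 1 * (\<Sum>i<n. (x i)\<^sup>2))"
    by (intro set_integrable_mult_right set_integral_sum(1)) (use sq_int in auto)
  have q_int: "set_integrable ?M K q"
    unfolding q_def by (intro set_integral_diff(1) one s_int)
  have "(LINT x:K|?M. q x) = (LINT x:K|?M. 1 + real n / 2) - pi * exp 1 * (LINT x:K|?M. (\<Sum>i<n. (x i)\<^sup>2))"
    unfolding q_def by (subst set_integral_diff(2)[OF one s_int]) simp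
  also have "(LINT x:K|?M. 1 + real n / 2) = 1 + real n / 2"
    using vol KR by (simp add: set_lebesgue_integral_def vol_def)
  also have "(LINT x:K|?M. (\<Sum>i<n. (x i)\<^sup>2)) = real n * L\<^sup>2"
    by (subst set_integral_sum(2)) (use sq_int coordinate_second_moment[OF L] in auto)
  finally have q_val: "(LINT x:K|?M. q x) = 1 + real n / 2 - pi * exp 1 * (real n * L\<^sup>2)" .
  define g where "g x = (\<Prod>i<n. normal_density 0 \<sigma> (x i))" for x
  have g_int: "integrable ?M g"
    unfolding g_def Rn_lborel_def using \<sigma> by (intro product_integrable_prod) auto
  have "(LINT x|?M. g x) = (\<Prod>i<n. LINT x|lborel. normal_density 0 \<sigma> x)"
    unfolding g_def Rn_lborel_def using \<sigma> by (intro product_integral_prod) auto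
  then have g_val: "(LINT x|?M. g x) = 1" using \<sigma> by simp
  have g_eq: "g x = exp (real n / 2 - pi * exp 1 * (\<Sum>i<n. (x i)\<^sup>2))" for x
    by (simp add: g_def dens exp_sum[symmetric] sum_subtractf sum_distrib_left)
  have q_le_g: "q x \<le> g x" for x
    using exp_ge_add_one_self[of "real n / 2 - pi * exp 1 * (\<Sum>i<n. (x i)\<^sup>2)"] unfolding q_def g_eq by linarith
  have "(LINT x:K|?M. q x) \<le> (LINT x|?M. g x)"
    unfolding set_lebesgue_integral_def
  proof (rule integral_mono)
    have "0 \<le> g x" for x by (simp add: g_eq)
    then show "indicat_real K x *\<^sub>R q x \<le> g x" for x
      using q_le_g by (simp add: indicator_def)
  qed (use q_int g_int in \<open>simp_all add: set_integrable_def\<close>)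
  then have "real n * (1 / 2) \<le> real n * (pi * exp 1 * L\<^sup>2)" unfolding q_val g_val by (simp add: mult_ac)
  then show ?thesis using n by simp
qed

text \<open>
  For an isotropic \<open>K\<close> the coordinate functionals serve as basis, with \<open>A = L\<^sub>K \<surd>(\<alpha> n / 2)\<close>; the total
  second moment over \<open>C\<close> is \<open>n L\<^sub>C\<^sup>2\<close>, and \<open>n\<close> cancels.
\<close>

lemma (in symmetric_body) multi_norm_isotropic_le:
  assumes tc: "two_convex n K \<alpha>" and \<alpha>: "0 < \<alpha>" and n: "n \<ge> 1" and isoK: "isotropic n K"
    and C: "convex_body n C" and isoC: "isotropic n C"
  shows "multi_norm n s C K t \<le> 2 * sqrt (pi * exp 1) * isotropic_constant n C / sqrt \<alpha> * L2_set t {..<s}"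
proof -
  obtain LK where LK: "has_isotropic_constant n K LK" using isoK by (auto simp: isotropic_def)
  obtain LC where LC: "has_isotropic_constant n C LC" using isoC by (auto simp: isotropic_def)
  have pos: "LK > 0" "LC > 0" using LK LC by (auto simp: has_isotropic_constant_def)
  have volK: "vol n K = 1" and volC: "vol n C = 1" using isoK isoC by (auto simp: isotropic_def)
  have np: "0 < \<alpha> * real n" using n \<alpha> by simp
  let ?A = "sqrt (\<alpha> * real n / 2) * LK"
  have "multi_norm n s C K t \<le> sqrt (real n * LC\<^sup>2) / ?A * L2_set t {..<s}"
  proof (rule multi_norm_le_functionals[where v = unit_vec])
    show "0 < ?A" using np pos by simp
    show "\<exists>a. \<forall>i<n. \<xi> i = (\<Sum>k<n. a k * unit_vec k i)" for \<xi>
      by (intro exI[of _ \<xi>]) (simp add: sum_unit_vec)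
    fix a h assume h: "0 < h" "\<forall>x\<in>K. vinner n x (\<lambda>i. \<Sum>k<n. a k * unit_vec k i) \<le> h"
    have "vinner n x (\<lambda>i. \<Sum>k<n. a k * unit_vec k i) = vinner n x a" for x
      by (rule vinner_cong) (simp add: sum_unit_vec)
    then have "\<alpha> * real n * (LK\<^sup>2 * (\<Sum>i<n. (a i)\<^sup>2)) \<le> 2 * h\<^sup>2"
      using two_convex_second_moment[OF tc \<alpha> n h(1), of a] h(2)
      by (simp add: isotropic_second_moment[OF LK] volK)
    then show "?A\<^sup>2 * (\<Sum>k<n. (a k)\<^sup>2) \<le> h\<^sup>2"
      using np by (simp add: power_mult_distrib field_simps)
  next
    fix k assume k: "k < n"
    have "barycenter n C k = 0" using isoC k by (simp add: isotropic_def)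
    then show "(LINT x:C|Rn_lborel n. vinner n x (unit_vec k)) = 0"
      using k by (simp add: barycenter_def volC)
    show "(LINT x:C|Rn_lborel n. (vinner n x (unit_vec k))\<^sup>2) \<le> LC\<^sup>2 * vol n C"
      using k by (simp add: coordinate_second_moment[OF LC] volC)
  qed (use C volC in auto)
  also have "sqrt (real n * LC\<^sup>2) / ?A = sqrt 2 * LC / (sqrt \<alpha> * LK)"
    using n \<alpha> pos by (simp add: real_sqrt_mult real_sqrt_divide field_simps)
  also have "sqrt 2 * LC / (sqrt \<alpha> * LK) * L2_set t {..<s}
      \<le> 2 * sqrt (pi * exp 1) * LC / sqrt \<alpha> * L2_set t {..<s}"
  proof (rule mult_right_mono)
    have "1 \<le> sqrt (2 * pi * exp 1 * LK\<^sup>2)"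
      using isotropic_constant_lower_bound[OF body volK LK n] by simp
    also have "\<dots> = sqrt 2 * sqrt (pi * exp 1) * LK" using pos by (simp add: real_sqrt_mult)
    finally have "sqrt 2 * 1 \<le> sqrt 2 * (sqrt 2 * sqrt (pi * exp 1) * LK)" by (intro mult_left_mono) auto
    also have "\<dots> = 2 * sqrt (pi * exp 1) * LK" by (simp add: mult.assoc[symmetric])
    finally have "sqrt 2 / LK \<le> 2 * sqrt (pi * exp 1)" using pos by (simp add: divide_le_eq)
    then have "sqrt 2 / LK * (LC / sqrt \<alpha>) \<le> 2 * sqrt (pi * exp 1) * (LC / sqrt \<alpha>)"
      using pos \<alpha> by (intro mult_right_mono) auto
    then show "sqrt 2 * LC / (sqrt \<alpha> * LK) \<le> 2 * sqrt (pi * exp 1) * LC / sqrt \<alpha>"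
      by (simp add: mult_ac)
  qed simp
  finally show ?thesis using isotropic_constant_eqI[OF n LC] by simp
qed

section \<open>The two bounds with a common constant\<close>

theorem theorem4p3:
  shows "\<exists>c::real. c > 0 \<and>
    (\<forall>(n::nat) (C::(nat \<Rightarrow> real) set) (K::(nat \<Rightarrow> real) set) (\<alpha>::real).
       n \<ge> 1 \<and> convex_body n C \<and> isotropic n C \<and>
       convex_body n K \<and> isotropic n K \<and> centrally_symmetric n K \<and> \<alpha> > 0 \<and> two_convex n K \<alpha> \<longrightarrow>
       (\<forall>(s::nat) (t::nat \<Rightarrow> real). s \<ge> 1 \<longrightarrow>
          multi_norm n s C K t \<le> c * isotropic_constant n C / sqrt \<alpha> * L2_set t {..<s})) \<and>
    (\<forall>(n::nat) (K::(nat \<Rightarrow> real) set) (\<alpha>::real).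
       n \<ge> 1 \<and> convex_body n K \<and> centrally_symmetric n K \<and> \<alpha> > 0 \<and> two_convex n K \<alpha> \<longrightarrow>
       (\<forall>(s::nat) (t::nat \<Rightarrow> real). s \<ge> 1 \<longrightarrow>
          multi_norm n s K K t \<le> c / \<alpha> * L2_set t {..<s}))"
proof (intro exI[of _ "2 * sqrt (pi * exp 1)"] conjI allI impI)
  show "0 < 2 * sqrt (pi * exp 1)" by simp
next
  fix n s :: nat and C K :: "(nat \<Rightarrow> real) set" and \<alpha> :: real and t :: "nat \<Rightarrow> real"
  assume *: "n \<ge> 1 \<and> convex_body n C \<and> isotropic n C \<and>
       convex_body n K \<and> isotropic n K \<and> centrally_symmetric n K \<and> \<alpha> > 0 \<and> two_convex n K \<alpha>"
  then interpret symmetric_body n K by unfold_locales auto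
  show "multi_norm n s C K t \<le> 2 * sqrt (pi * exp 1) * isotropic_constant n C / sqrt \<alpha> * L2_set t {..<s}"
    using * by (intro multi_norm_isotropic_le) auto
next
  fix n s :: nat and K :: "(nat \<Rightarrow> real) set" and \<alpha> :: real and t :: "nat \<Rightarrow> real"
  assume *: "n \<ge> 1 \<and> convex_body n K \<and> centrally_symmetric n K \<and> \<alpha> > 0 \<and> two_convex n K \<alpha>" and s: "s \<ge> 1"
  then interpret symmetric_body n K by unfold_locales auto
  have \<alpha>: "0 < \<alpha>" "\<alpha> \<le> 1" using * two_convex_constant_le_1 by auto
  have "multi_norm n s K K t \<le> 2 / sqrt \<alpha> * L2_set t {..<s}"
    using * s by (intro multi_norm_self_le) auto
  also have "\<dots> \<le> 2 * sqrt (pi * exp 1) / \<alpha> * L2_set t {..<s}"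
  proof (intro mult_right_mono frac_le)
    have "1 * 1 \<le> pi * exp 1" using pi_ge_two by (intro mult_mono) auto
    then have "1 \<le> sqrt (pi * exp 1)" by simp
    then show "2 \<le> 2 * sqrt (pi * exp 1)" by simp
    show "\<alpha> \<le> sqrt \<alpha>" using \<alpha> by (intro real_le_rsqrt) (simp add: power2_eq_square mult_left_le)
  qed (use \<alpha> in auto)
  finally show "multi_norm n s K K t \<le> 2 * sqrt (pi * exp 1) / \<alpha> * L2_set t {..<s}" .
qed

end
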